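(* Let $\mu,\nu$ be probability measures on $\mathcal{X}$ with $\mu\ll\nu$. Assume the measurement channel is continuous in total variation: whenever $a_n\to a$ in $\mathcal{X}$, $\|h_{a_n}Q-h_aQ\|_{TV}\to0$. If the one step predictors $\pi_{n-}^\mu$ and $\pi_{n-}^\nu$ merge weakly $P^\mu$-almost surely, then the filters merge weakly in expectation: for every $f\in C_b(\mathcal{X})$, $\lim_{n\to\infty}E^\mu\left[\left|\int f\,d\pi_n^\mu-\int f\,d\pi_n^\nu\right|\right]=0$.
   Context: Setting: $\mathcal{X},\mathcal{Y},\mathcal{Z}$ are Polish spaces. $T$ is a transition kernel on $\mathcal{X}$; $\{Z_n\}$ is i.i.d. with law $Q$, independent of the states; $h:\mathcal{X}\times\mathcal{Z}\to\mathcal{Y}$ measurable, $h_x:=h(x,\cdot)$, and $h_xQ$ is the pushforward of $Q$ under $h_x$ (the conditional law of $Y_n$ given $X_n=x$). $\{X_n\}$ is a Markov chain with kernel $T$, $X_0\sim\mu$, $Y_n=h(X_n,Z_n)$; $P^\mu$, $E^\mu$ are the joint law and expectation. Predictor $\pi_{n-}^{\mu}=P^{\mu}(X_n\in\cdot\mid Y_0,\dots,Y_{n-1})$; filter $\pi_n^{\mu}=P^{\mu}(X_n\in\cdot\mid Y_0,\dots,Y_n)$. Total variation: $\|P-R\|_{TV}=\sup_{\|f\|_\infty\le1}|\int f\,dP-\int f\,dR|$ over measurable $f$. Weak merging $P^\mu$-a.s. of predictors: $P^\mu$-a.s., $|\int f d\pi_{n-}^\mu-\int f d\pi_{n-}^\nu|\to0$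 for every $f\in C_b(\mathcal{X})$. *)

theory Defs
  imports "HOL-Probability.Probability"
begin

definition tv_dist :: "'a measure \<Rightarrow> 'a measure \<Rightarrow> real" where
  "tv_dist P R = Sup {\<bar>(\<integral>y. f y \<partial>P) - (\<integral>y. f y \<partial>R)\<bar> | f.
      f \<in> borel_measurable (P) \<and> (\<forall>y. \<bar>f y\<bar> \<le> 1)}"

definition Cb :: "('a::topological_space \<Rightarrow> real) set" where
  "Cb = {f. continuous_on UNIV f \<and> bounded (range f)}"

text \<open>Hidden Markov model realized on a probability space M: X is a Markov chain with
  initial law mu and kernel T; Z is i.i.d. with law Q and independent of X.\<close>
definition HMM :: "'w measure \<Rightarrow> ('x::topological_space) measure \<Rightarrow> ('x \<Rightarrow> 'x measure)
    \<Rightarrow> ('z::topological_space) measure \<Rightarrow> (nat \<Rightarrow> 'w \<Rightarrow> 'x) \<Rightarrow> (nat \<Rightarrow> 'w \<Rightarrow> 'z) \<Rightarrow> bool" where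
  "HMM M \<mu> T Q X Z \<longleftrightarrow>
     prob_space M \<and>
     (\<forall>n. X n \<in> borel_measurable M) \<and> (\<forall>n. Z n \<in> borel_measurable M) \<and>
     distr M borel (X 0) = \<mu> \<and>
     (\<forall>n A. (\<forall>i. A i \<in> sets borel) \<longrightarrow>
        measure M {\<omega>\<in>space M. \<forall>i\<le>Suc n. X i \<omega> \<in> A i} =
        (\<integral>\<omega>. indicator {\<omega>\<in>space M. \<forall>i\<le>n. X i \<omega> \<in> A i} \<omega> * measure (T (X n \<omega>)) (A (Suc n)) \<partial>M)) \<and>
     prob_space.indep_vars M (\<lambda>_. borel) Z UNIV \<and>
     (\<forall>n. distr M borel (Z n) = Q) \<and>
     prob_space.indep_set M
        (sets (vimage_algebra (space M) (\<lambda>\<omega> i. X i \<omega>) (PiM UNIV (\<lambda>_. borel))))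
        (sets (vimage_algebra (space M) (\<lambda>\<omega> i. Z i \<omega>) (PiM UNIV (\<lambda>_. borel))))"

definition obs :: "('x \<times> 'z \<Rightarrow> 'y) \<Rightarrow> (nat \<Rightarrow> 'w \<Rightarrow> 'x) \<Rightarrow> (nat \<Rightarrow> 'w \<Rightarrow> 'z) \<Rightarrow> nat set
    \<Rightarrow> 'w \<Rightarrow> (nat \<Rightarrow> 'y)" where
  "obs h X Z I \<omega> = (\<lambda>i\<in>I. h (X i \<omega>, Z i \<omega>))"

definition cond_dist :: "'w measure \<Rightarrow> ('x \<times> 'z \<Rightarrow> ('y::topological_space))
    \<Rightarrow> (nat \<Rightarrow> 'w \<Rightarrow> ('x::topological_space)) \<Rightarrow> (nat \<Rightarrow> 'w \<Rightarrow> 'z) \<Rightarrow> nat set \<Rightarrow> nat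
    \<Rightarrow> ((nat \<Rightarrow> 'y) \<Rightarrow> 'x measure) \<Rightarrow> bool" where
  "cond_dist M h X Z I n F \<longleftrightarrow>
     F \<in> PiM I (\<lambda>_. borel) \<rightarrow>\<^sub>M prob_algebra borel \<and>
     (\<forall>B\<in>sets (PiM I (\<lambda>_. borel)). \<forall>A\<in>sets borel.
        measure M {\<omega>\<in>space M. obs h X Z I \<omega> \<in> B \<and> X n \<omega> \<in> A} =
        (\<integral>\<omega>. indicator B (obs h X Z I \<omega>) * measure (F (obs h X Z I \<omega>)) A \<partial>M))"

end

theory Submission
  imports Defs
begin

text \<open>Let \<open>F\<^sub>1\<close>, \<open>F\<^sub>2\<close> be the two filters integrated against \<open>f\<close>, and let \<open>\<psi>\<close> be the sign of
  \<open>F\<^sub>1 - F\<^sub>2\<close>, as functions of the observations. By Bayes' rule, \<open>E\<^sup>\<mu>\<bar>F\<^sub>1 - F\<^sub>2\<bar>\<close> is the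
  \<open>\<mu>\<close>-expectation of the integral of
  \<open>D x = \<integral> \<psi> (h (x, z)) * (f x - F\<^sub>2 (h (x, z))) dQ\<close> against the \<open>\<mu>\<close>-predictor. The integral of
  \<open>D\<close> against the \<open>\<nu>\<close>-predictor vanishes almost surely under \<open>\<nu>\<close>, hence also under \<open>\<mu>\<close> by absolute
  continuity. So the error is the expected difference of the two predictors on \<open>D\<close>. Continuity of
  the channel in total variation makes the functions \<open>D\<close> equicontinuous in \<open>x\<close>, uniformly in the time
  and in \<open>\<psi>\<close>, and weak merging of probability measures is uniform over bounded equicontinuous
  sequences of functions; dominated convergence finishes the proof.\<close>

section \<open>Weak merging and equicontinuity\<close>

text \<open>Two obstacles shape the proof. The predictors along an observation path need not be
  tight, so compactness arguments of Arzela-Ascoli type cannot make weak merging uniform over the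
  functions \<open>D\<close>. A single countable partition of unity, fine enough for the whole
  sequence, takes their place and moves the question to absolutely summable sequences. Secondly,
  \<open>D\<close> changes with the time and the observed path, and it contains the \<nu>-filter,
  which is merely measurable in the new observation. Its dependence on \<open>x\<close> is tame all
  the same: \<open>x\<close> enters only through \<open>f x\<close> and through the law of
  \<open>h (x, z)\<close>, and channel laws close in total variation integrate all measurable
  functions with a common bound almost alike. Weak continuity of the channel would not give this.
  Bayes' rule is used only in integrated form, tested against functions of the observations, so that
  no channel densities appear.\<close>

text \<open>For each choice of signs the series is eventually small, so by Baire's theorem this happens
  uniformly on some cylinder of sign sequences; outside finitely many coordinates the signs are then
  free.\<close>

lemma schur_l1:
  fixes a :: "nat \<Rightarrow> nat \<Rightarrow> real"
  assumes summ: "\<And>n. summable (\<lambda>k. \<bar>a n k\<bar>)"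
    and weak: "\<And>c. (\<And>k. \<bar>c k\<bar> \<le> 1) \<Longrightarrow> (\<lambda>n. \<Sum>k. c k * a n k) \<longlonglongrightarrow> 0"
  shows "(\<lambda>n. \<Sum>k. \<bar>a n k\<bar>) \<longlonglongrightarrow> 0"
proof -
  \<comment> \<open>Clipping extends the functional from sequences in [-1,1] to all of
    \<open>nat \<Rightarrow> real\<close>, so Baire's theorem applies to the whole type with its
    product topology. Dominated by \<open>\<bar>a n k\<bar>\<close> uniformly in \<open>c\<close>,
    the clipped series is continuous there.\<close>
  define clip :: "real \<Rightarrow> real" where "clip t = max (-1) (min 1 t)" for t
  have clip1: "\<bar>clip t\<bar> \<le> 1" for t by (auto simp: clip_def)
  have clip2: "clip t = t" if "\<bar>t\<bar> \<le> 1" for t using that by (auto simp: clip_def)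
  have summ': "summable (\<lambda>k. c k * a n k)" if "\<And>k. \<bar>c k\<bar> \<le> 1" for c n
    by (rule summable_comparison_test'[OF summ[of n], of 0])
      (use that in \<open>auto simp: abs_mult intro!: mult_left_le_one_le\<close>)
  have coord: "(\<lambda>n. a n k) \<longlonglongrightarrow> 0" for k
  proof -
    have "(\<Sum>j. (if j = k then 1 else 0) * a n j) = a n k" for n
      using suminf_finite[of "{k}" "\<lambda>j. (if j = k then 1 else 0) * a n j"] by auto
    then show ?thesis using weak[of "\<lambda>j. if j = k then 1 else 0"] by simp
  qed
  define L where "L n c = (\<Sum>k. clip (c k) * a n k)" for n and c :: "nat \<Rightarrow> real"
  have contL: "continuous_on UNIV (L n)" for n
  proof -
    have "uniform_limit UNIV (\<lambda>m c. \<Sum>k<m. clip (c k) * a n k) (L n) sequentially"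
      unfolding L_def
      by (rule Weierstrass_m_test[OF _ summ[of n]])
        (use clip1 in \<open>auto simp: abs_mult intro!: mult_left_le_one_le\<close>)
    moreover have "continuous_on UNIV (\<lambda>c :: nat \<Rightarrow> real. \<Sum>k<m. clip (c k) * a n k)" for m
      unfolding clip_def by (intro continuous_intros) auto
    ultimately show ?thesis
      by (intro uniform_limit_theorem[rotated]) auto
  qed
  show ?thesis
  proof (rule LIMSEQ_I)
    fix e :: real assume "0 < e"
    define A where "A N = {c. \<forall>n\<ge>N. \<bar>L n c\<bar> \<le> e / 3}" for N
    have clA: "closed (A N)" for N
    proof -
      have "A N = (\<Inter>n\<in>{N..}. {c. \<bar>L n c\<bar> \<le> e / 3})" by (auto simp: A_def)
      moreover have "closed {c. \<bar>L n c\<bar> \<le> e / 3}" for n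
        by (intro closed_Collect_le continuous_intros contL)
      ultimately show ?thesis by auto
    qed
    have "c \<in> (\<Union>N. A N)" for c
    proof -
      have "(\<lambda>n. L n c) \<longlonglongrightarrow> 0" unfolding L_def by (rule weak) (rule clip1)
      then have "\<forall>\<^sub>F n in sequentially. \<bar>L n c\<bar> < e / 3"
        using \<open>0 < e\<close> by (auto dest!: tendstoD[where e = "e / 3"])
      then show ?thesis by (auto simp: A_def eventually_sequentially intro: less_imp_le)
    qed
    then have UN: "\<Union> (range A) = UNIV" by auto
    have "\<exists>N. interior (A N) \<noteq> {}"
    proof (rule ccontr)
      assume *: "\<not> ?thesis"
      have "euclidean interior_of \<Union> (range A) = {}"
      proof (rule Baire_category_alt)
        show "completely_metrizable_space (euclidean :: (nat \<Rightarrow> real) topology) \<or>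
           locally_compact_space (euclidean :: (nat \<Rightarrow> real) topology) \<and> regular_space (euclidean :: (nat \<Rightarrow> real) topology)"
          by (simp add: completely_metrizable_space_euclidean)
      qed (use * clA in auto)
      then show False by (simp add: UN)
    qed
    then obtain N c0 where c0: "c0 \<in> interior (A N)" by blast
    obtain V where V: "c0 \<in> Pi\<^sub>E UNIV V" "finite {i. V i \<noteq> UNIV}" "Pi\<^sub>E UNIV V \<subseteq> interior (A N)"
      using product_topology_open_contains_basis[of "\<lambda>_. euclidean" UNIV "interior (A N)" c0] c0
      by (force simp: open_fun_def[symmetric])
    define F where "F = {i. V i \<noteq> UNIV}"
    have finF: "finite F" using V F_def by simp
    have F: "c \<in> A N" if "\<And>k. k \<in> F \<Longrightarrow> c k = c0 k" for c
    proof -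
      have "c \<in> Pi\<^sub>E UNIV V"
        using that V(1) by (auto simp: F_def PiE_iff) (metis UNIV_I)
      then show ?thesis using V(3) interior_subset by blast
    qed
    \<comment> \<open>Off \<open>F\<close> the sequence \<open>c\<close> can follow the signs of
      \<open>a n\<close>, so those terms of \<open>L n c\<close> already equal
      \<open>\<bar>a n k\<bar>\<close>. On \<open>F\<close> the prescribed values \<open>c0\<close>
      cost at most \<open>2 * \<bar>a n k\<bar>\<close> each, and these finitely many terms vanish
      in the limit by \<open>coord\<close>.\<close>
    have bd: "(\<Sum>k. \<bar>a n k\<bar>) \<le> e / 3 + 2 * (\<Sum>k\<in>F. \<bar>a n k\<bar>)" if "n \<ge> N" for n
    proof -
      define c where "c k = (if k \<in> F then c0 k else sgn (a n k))" for k
      have "c \<in> A N" by (rule F) (simp add: c_def)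
      then have Lc: "\<bar>L n c\<bar> \<le> e / 3" using that by (simp add: A_def)
      have s1: "summable (\<lambda>k. clip (c k) * a n k)" by (rule summ') (rule clip1)
      have "(\<Sum>k. \<bar>a n k\<bar>) - L n c = (\<Sum>k. \<bar>a n k\<bar> - clip (c k) * a n k)"
        unfolding L_def by (rule suminf_diff[OF summ s1])
      also have "\<dots> = (\<Sum>k\<in>F. \<bar>a n k\<bar> - clip (c k) * a n k)"
        by (rule suminf_finite[OF finF])
          (auto simp: c_def clip2 abs_sgn_eq abs_sgn mult.commute)
      also have "\<dots> \<le> (\<Sum>k\<in>F. 2 * \<bar>a n k\<bar>)"
      proof (rule sum_mono)
        fix k
        have "\<bar>clip (c k) * a n k\<bar> \<le> \<bar>a n k\<bar>"
          using clip1[of "c k"] by (auto simp: abs_mult intro!: mult_left_le_one_le)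
        then show "\<bar>a n k\<bar> - clip (c k) * a n k \<le> 2 * \<bar>a n k\<bar>" by linarith
      qed
      finally show ?thesis using Lc by (simp add: sum_distrib_left)
    qed
    have "(\<lambda>n. 2 * (\<Sum>k\<in>F. \<bar>a n k\<bar>)) \<longlonglongrightarrow> 2 * (\<Sum>k\<in>F. \<bar>0\<bar>)"
      by (intro tendsto_intros coord)
    from tendstoD[OF this, of "e / 3"] \<open>0 < e\<close>
    have "\<forall>\<^sub>F n in sequentially. \<bar>2 * (\<Sum>k\<in>F. \<bar>a n k\<bar>)\<bar> < e / 3"
      by (simp only: dist_real_def) simp
    then obtain N' where N': "\<And>n. n \<ge> N' \<Longrightarrow> \<bar>2 * (\<Sum>k\<in>F. \<bar>a n k\<bar>)\<bar> < e / 3"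
      by (auto simp: eventually_sequentially)
    have "norm ((\<Sum>k. \<bar>a n k\<bar>) - 0) < e" if "n \<ge> max N N'" for n
    proof -
      have "0 \<le> (\<Sum>k. \<bar>a n k\<bar>)" by (rule suminf_nonneg[OF summ]) simp
      then show ?thesis using bd[of n] N'[of n] that \<open>0 < e\<close> by auto
    qed
    then show "\<exists>no. \<forall>n\<ge>no. norm ((\<Sum>k. \<bar>a n k\<bar>) - 0) < e" by blast
  qed
qed

text \<open>The weight \<open>p k y\<close> is the probability that the first success of independent
  trials with success probabilities \<open>q j y\<close> occurs at trial \<open>k\<close>. By
  Lindelof, countably many half-radius balls cover the space, and on the half-radius ball around
  \<open>c j\<close> trial \<open>j\<close> is certain to succeed. There all later weights vanish,
  which gives local finiteness and total weight exactly 1 without normalising.\<close>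

lemma partition_of_unity_subordinate_balls:
  fixes r :: "'x::{metric_space, second_countable_topology} \<Rightarrow> real"
  assumes r: "\<And>x. 0 < r x"
  obtains p :: "nat \<Rightarrow> 'x \<Rightarrow> real" and c :: "nat \<Rightarrow> 'x"
  where "\<And>k. continuous_on UNIV (p k)" "\<And>k x. 0 \<le> p k x"
    "\<And>k x. p k x \<noteq> 0 \<Longrightarrow> dist x (c k) < r (c k)" "\<And>x. (\<lambda>k. p k x) sums 1"
    "\<And>x. \<exists>U m. open U \<and> x \<in> U \<and> (\<forall>y\<in>U. \<forall>k\<ge>m. p k y = 0)"
proof -
  obtain \<F> where \<F>: "\<F> \<subseteq> range (\<lambda>x. ball x (r x / 2))" "countable \<F>"
      "\<Union>\<F> = \<Union> (range (\<lambda>x. ball x (r x / 2)))"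
    by (rule Lindelof[of "range (\<lambda>x. ball x (r x / 2))"]) auto
  obtain C where C: "countable C" "\<F> = (\<lambda>x. ball x (r x / 2)) ` C"
    using countable_subset_image[of \<F> "\<lambda>x. ball x (r x / 2)" UNIV] \<F> by auto
  have cover: "\<exists>x\<in>C. dist y x < r x / 2" for y
  proof -
    have "y \<in> ball y (r y / 2)" using r[of y] by simp
    then have "y \<in> \<Union>\<F>" using \<F>(3) by blast
    then show ?thesis by (auto simp: C dist_commute)
  qed
  then have "C \<noteq> {}" by blast
  define c where "c = from_nat_into C"
  have c: "\<exists>k. dist y (c k) < r (c k) / 2" for y
    using cover[of y] \<open>countable C\<close> unfolding c_def by (metis from_nat_into_surj)
  \<comment> \<open>The affine expression equals 1 at half the radius and 0 at the full
    radius.\<close>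
  define q where "q k y = max 0 (min 1 (2 - 2 * dist y (c k) / r (c k)))" for k y
  define p where "p k y = q k y * (\<Prod>j<k. 1 - q j y)" for k y
  have q01: "0 \<le> q k y" "q k y \<le> 1" for k y by (auto simp: q_def)
  have q1: "q k y = 1" if "dist y (c k) < r (c k) / 2" for k y
    using that r[of "c k"] by (simp add: q_def min_def max_def field_simps)
  have psum: "(\<Sum>k<m. p k y) = 1 - (\<Prod>j<m. 1 - q j y)" for m y
    by (induction m) (auto simp: p_def algebra_simps)
  have p0: "p k y = 0" if "dist y (c j) < r (c j) / 2" "j < k" for j k y
    using q1[OF that(1)] that(2) unfolding p_def by (auto intro!: prod_zero)
  show ?thesis
  proof
    show "continuous_on UNIV (p k)" for k
      unfolding p_def q_def using r by (intro continuous_intros) (auto simp: less_imp_neq[THEN not_sym])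
    show "0 \<le> p k x" for k x
      unfolding p_def using q01 by (intro mult_nonneg_nonneg prod_nonneg) auto
    show "dist x (c k) < r (c k)" if "p k x \<noteq> 0" for k x
    proof -
      have "q k x \<noteq> 0" using that by (auto simp: p_def)
      then show ?thesis using r[of "c k"] by (auto simp: q_def max_def min_def field_simps split: if_splits)
    qed
    show "(\<lambda>k. p k x) sums 1" for x
    proof -
      obtain j where j: "dist x (c j) < r (c j) / 2" using c by blast
      have "(\<lambda>k. p k x) sums (\<Sum>k<Suc j. p k x)"
        by (rule sums_finite) (use p0[OF j] in auto)
      also have "(\<Sum>k<Suc j. p k x) = 1" unfolding psum using q1[OF j] by simp
      finally show ?thesis .
    qed
    show "\<exists>U m. open U \<and> x \<in> U \<and> (\<forall>y\<in>U. \<forall>k\<ge>m. p k y = 0)" for x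
    proof -
      obtain j where j: "dist x (c j) < r (c j) / 2" using c by blast
      then show ?thesis
        by (intro exI[of _ "ball (c j) (r (c j) / 2)"] exI[of _ "Suc j"])
          (auto simp: dist_commute intro!: p0[of _ j])
    qed
  qed
qed

text \<open>A locally finite partition of unity turns weak merging into weak convergence to zero in
  \<open>\<ell>\<^sup>1\<close>, which by Schur's theorem is norm convergence.\<close>

lemma weak_merging_equicontinuous:
  fixes P R :: "nat \<Rightarrow> 'x::{metric_space, second_countable_topology} measure"
    and g :: "nat \<Rightarrow> 'x \<Rightarrow> real"
  assumes P: "\<And>n. prob_space (P n)" "\<And>n. sets (P n) = sets borel"
    and R: "\<And>n. prob_space (R n)" "\<And>n. sets (R n) = sets borel"
    and merge: "\<And>f. f \<in> Cb \<Longrightarrow> (\<lambda>n. (\<integral>x. f x \<partial>P n) - (\<integral>x. f x \<partial>R n)) \<longlonglongrightarrow> 0"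
    and equi: "\<And>x e. 0 < e \<Longrightarrow> \<exists>d>0. \<forall>y n. dist y x < d \<longrightarrow> \<bar>g n y - g n x\<bar> \<le> e"
    and bound: "\<And>n x. \<bar>g n x\<bar> \<le> C"
  shows "(\<lambda>n. (\<integral>x. g n x \<partial>P n) - (\<integral>x. g n x \<partial>R n)) \<longlonglongrightarrow> 0"
proof (rule LIMSEQ_I)
  fix e0 :: real assume "0 < e0"
  \<comment> \<open>Three errors of size \<open>e\<close> will occur: replacing \<open>g n\<close>
    by a series under \<open>P n\<close>, the same under \<open>R n\<close>, and the difference of
    the two integrals of that series.\<close>
  define e where "e = e0 / 4"
  have "0 < e" using \<open>0 < e0\<close> by (simp add: e_def)
  have contg: "continuous_on UNIV (g n)" for n
    unfolding continuous_on_iff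
  proof (intro ballI allI impI)
    fix x and e :: real assume "0 < e"
    then obtain d where "d > 0" "\<And>y n. dist y x < d \<Longrightarrow> \<bar>g n y - g n x\<bar> \<le> e / 2"
      using equi[of "e / 2" x] by auto
    moreover have "t < e" if "t \<le> e / 2" for t using that \<open>0 < e\<close> by linarith
    ultimately show "\<exists>d>0. \<forall>x'\<in>UNIV. dist x' x < d \<longrightarrow> dist (g n x') (g n x) < e"
      unfolding dist_real_def by blast
  qed
  \<comment> \<open>The radius at \<open>x\<close> is common to all \<open>n\<close>; hence one
    partition of unity serves the whole sequence.\<close>
  have "\<exists>d>0. \<forall>y n. dist y x < d \<longrightarrow> \<bar>g n y - g n x\<bar> \<le> e" for x using equi \<open>0 < e\<close> by blast
  then have "\<forall>x. \<exists>d. d > 0 \<and> (\<forall>y n. dist y x < d \<longrightarrow> \<bar>g n y - g n x\<bar> \<le> e)" by blast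
  from choice[OF this] obtain r where
    r: "\<And>x. 0 < r x" "\<And>x y n. dist y x < r x \<Longrightarrow> \<bar>g n y - g n x\<bar> \<le> e" by blast
  obtain p :: "nat \<Rightarrow> 'x \<Rightarrow> real" and c :: "nat \<Rightarrow> 'x"
    where contp: "\<And>k. continuous_on UNIV (p k)" and p0: "\<And>k x. 0 \<le> p k x"
    and supp: "\<And>k x. p k x \<noteq> 0 \<Longrightarrow> dist x (c k) < r (c k)" and p1: "\<And>x. (\<lambda>k. p k x) sums 1"
    and locfin: "\<And>x. \<exists>U m. open U \<and> x \<in> U \<and> (\<forall>y\<in>U. \<forall>k\<ge>m. p k y = 0)"
    by (rule partition_of_unity_subordinate_balls[of r, OF r(1)]) (rule that)
  \<comment> \<open>Any bounded coefficients give a function in \<open>Cb\<close>, since near each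
    point the series is a finite sum. These are the test functions to which merging is
    applied.\<close>
  define S where "S b x = (\<Sum>k. b k * p k x)" for b :: "nat \<Rightarrow> real" and x
  have summp: "summable (\<lambda>k. p k x)" for x using p1 sums_summable by blast
  have summS: "summable (\<lambda>k. \<bar>b k * p k x\<bar>)" if "\<And>k. \<bar>b k\<bar> \<le> B" for b B x
    by (rule summable_comparison_test'[OF summable_mult[OF summp[of x], of B], of 0])
      (use that p0 in \<open>auto simp: abs_mult intro!: mult_right_mono\<close>)
  have partial: "\<bar>\<Sum>k<m. b k * p k x\<bar> \<le> B" if "\<And>k. \<bar>b k\<bar> \<le> B" for b B m x
  proof -
    have "B \<ge> 0" using that[of 0] by linarith
    have "\<bar>\<Sum>k<m. b k * p k x\<bar> \<le> (\<Sum>k<m. B * p k x)"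
      by (rule order.trans[OF sum_abs], rule sum_mono)
        (use that p0 in \<open>auto simp: abs_mult intro!: mult_right_mono\<close>)
    also have "\<dots> = B * (\<Sum>k<m. p k x)" by (simp add: sum_distrib_left)
    also have "\<dots> \<le> B * 1"
      using sum_le_suminf[OF summp[of x], of "{..<m}"] p0 p1[of x] \<open>B \<ge> 0\<close>
      by (intro mult_left_mono) (auto simp: sums_iff)
    finally show ?thesis by simp
  qed
  have Slim: "(\<lambda>m. \<Sum>k<m. b k * p k x) \<longlonglongrightarrow> S b x" if "\<And>k. \<bar>b k\<bar> \<le> B" for b B x
    unfolding S_def using summable_LIMSEQ[OF summable_rabs_cancel[OF summS[OF that]]] .
  have Sbound: "\<bar>S b x\<bar> \<le> B" if "\<And>k. \<bar>b k\<bar> \<le> B" for b B x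
    by (rule LIMSEQ_le_const2[OF tendsto_rabs[OF Slim[OF that]]]) (use partial[OF that] in auto)
  have contS: "continuous_on UNIV (S b)" for b
    unfolding continuous_on_eq_continuous_at[OF open_UNIV]
  proof
    fix x
    obtain U m where U: "open U" "x \<in> U" "\<And>y k. y \<in> U \<Longrightarrow> k \<ge> m \<Longrightarrow> p k y = 0"
      using locfin[of x] by blast
    have "S b y = (\<Sum>k<m. b k * p k y)" if "y \<in> U" for y
      unfolding S_def by (rule suminf_finite) (use U(3)[OF that] in auto)
    moreover have "continuous_on U (\<lambda>y. \<Sum>k<m. b k * p k y)"
      by (intro continuous_intros continuous_on_subset[OF contp]) auto
    ultimately have "continuous_on U (S b)" by (simp cong: continuous_on_cong)
    then show "isCont (S b) x" using U by (simp add: continuous_on_eq_continuous_at)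
  qed
  have SCb: "S b \<in> Cb" if "\<And>k. \<bar>b k\<bar> \<le> B" for b B
    using Sbound[of b B, OF that] contS by (auto simp: Cb_def bounded_iff)
  have Sint: "(\<lambda>k. b k * (\<integral>x. p k x \<partial>D)) sums (\<integral>x. S b x \<partial>D)"
    if "prob_space D" "sets D = sets borel" "\<And>k. \<bar>b k\<bar> \<le> B" for D b B
  proof -
    interpret prob_space D by fact
    have [measurable_cong]: "sets D = sets borel" by fact
    have [measurable]: "p k \<in> borel_measurable borel" "S b \<in> borel_measurable borel" for k
      using contp contS by (auto intro: borel_measurable_continuous_onI)
    have ple: "p k x \<le> 1" for k x
      using sum_le_suminf[OF summp[of x], of "{k}"] p0 p1[of x] by (auto simp: sums_iff)
    have intp: "integrable D (p k)" for k
      by (rule integrable_const_bound[where B = 1]) (use p0 ple in auto)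
    have "(\<lambda>m. \<integral>x. (\<Sum>k<m. b k * p k x) \<partial>D) \<longlonglongrightarrow> (\<integral>x. S b x \<partial>D)"
      by (rule integral_dominated_convergence[where w = "\<lambda>_. B"])
        (use Slim[OF that(3)] partial[OF that(3)] in auto)
    then show ?thesis using intp by (simp add: sums_def)
  qed
  \<comment> \<open>By \<open>asums\<close>, weak merging on all the functions \<open>S b\<close> is
    precisely the weak convergence of \<open>a n\<close> to zero that \<open>schur_l1\<close> asks
    for.\<close>
  define a where "a n k = (\<integral>x. p k x \<partial>P n) - (\<integral>x. p k x \<partial>R n)" for n k
  have asums: "(\<lambda>k. b k * a n k) sums ((\<integral>x. S b x \<partial>P n) - (\<integral>x. S b x \<partial>R n))"
    if "\<And>k. \<bar>b k\<bar> \<le> B" for b B n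
    using sums_diff[OF Sint[OF P that] Sint[OF R that]] by (simp add: a_def algebra_simps)
  have summa: "summable (\<lambda>k. \<bar>a n k\<bar>)" for n
  proof (rule summable_comparison_test'[where N = 0])
    show "summable (\<lambda>k. (\<integral>x. p k x \<partial>P n) + (\<integral>x. p k x \<partial>R n))"
      using Sint[OF P, of "\<lambda>_. 1" 1 n] Sint[OF R, of "\<lambda>_. 1" 1 n]
      by (auto intro!: summable_add simp: sums_iff)
    show "norm \<bar>a n k\<bar> \<le> (\<integral>x. p k x \<partial>P n) + (\<integral>x. p k x \<partial>R n)" for k
    proof -
      have "0 \<le> (\<integral>x. p k x \<partial>P n)" "0 \<le> (\<integral>x. p k x \<partial>R n)" using p0 by simp_all
      then show ?thesis by (auto simp: a_def)
    qed
  qed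
  have "(\<lambda>n. \<Sum>k. \<bar>a n k\<bar>) \<longlonglongrightarrow> 0"
  proof (rule schur_l1[OF summa])
    fix b :: "nat \<Rightarrow> real" assume b: "\<And>k. \<bar>b k\<bar> \<le> 1"
    show "(\<lambda>n. \<Sum>k. b k * a n k) \<longlonglongrightarrow> 0"
      using merge[OF SCb[OF b]] asums[OF b] by (simp add: sums_iff)
  qed
  then have "(\<lambda>n. C * (\<Sum>k. \<bar>a n k\<bar>)) \<longlonglongrightarrow> 0" by (auto intro: tendsto_eq_intros)
  then have "\<forall>\<^sub>F n in sequentially. \<bar>C * (\<Sum>k. \<bar>a n k\<bar>)\<bar> < e"
    using \<open>0 < e\<close> by (auto dest!: tendstoD[where e = e])
  then obtain N where N: "\<And>n. n \<ge> N \<Longrightarrow> \<bar>C * (\<Sum>k. \<bar>a n k\<bar>)\<bar> < e"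
    by (auto simp: eventually_sequentially)
  have "norm ((\<integral>x. g n x \<partial>P n) - (\<integral>x. g n x \<partial>R n) - 0) < e0" if "n \<ge> N" for n
  proof -
    \<comment> \<open>The coefficients depend on \<open>n\<close>, so convergence for each fixed
      \<open>b\<close> would not be enough. The norm convergence from \<open>schur_l1\<close> covers
      all coefficients bounded by \<open>C\<close> simultaneously.\<close>
    define b where "b k = g n (c k)" for k
    have b: "\<bar>b k\<bar> \<le> C" for k by (simp add: b_def bound)
    have approx: "\<bar>g n x - S b x\<bar> \<le> e" for x
    proof -
      have "(\<lambda>m. \<Sum>k<m. g n x * p k x - b k * p k x) \<longlonglongrightarrow> g n x - S b x"
        unfolding sum_subtractf
        using sums_mult[OF p1[of x], of "g n x"] by (intro tendsto_diff Slim[OF b]) (simp add: sums_def)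
      moreover have "\<bar>\<Sum>k<m. g n x * p k x - b k * p k x\<bar> \<le> e" for m
      proof -
        \<comment> \<open>Only indices with \<open>p k x \<noteq> 0\<close> matter, and for those
          \<open>x\<close> lies within the radius of \<open>c k\<close>. Setting the other
          coefficients to 0 makes \<open>partial\<close> applicable with bound
          \<open>e\<close>.\<close>
        have "(\<Sum>k<m. g n x * p k x - b k * p k x)
            = (\<Sum>k<m. (if p k x = 0 then 0 else g n x - b k) * p k x)"
          by (rule sum.cong) (auto simp: algebra_simps)
        also have "\<bar>\<dots>\<bar> \<le> e"
          by (rule partial) (use supp r(2) \<open>0 < e\<close> in \<open>auto simp: b_def\<close>)
        finally show ?thesis .
      qed
      ultimately show ?thesis
        by (intro LIMSEQ_le_const2[OF tendsto_rabs]) auto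
    qed
    have approxD: "\<bar>(\<integral>x. g n x \<partial>D) - (\<integral>x. S b x \<partial>D)\<bar> \<le> e"
      if "prob_space D" "sets D = sets borel" for D
    proof -
      interpret prob_space D by fact
      have [measurable_cong]: "sets D = sets borel" by fact
      have [measurable]: "g n \<in> borel_measurable borel" "S b \<in> borel_measurable borel"
        using contg contS by (auto intro: borel_measurable_continuous_onI)
      have "integrable D (g n)" "integrable D (S b)"
        by (auto intro!: integrable_const_bound[where B = C] simp: bound Sbound[OF b])
      then have "(\<integral>x. g n x \<partial>D) - (\<integral>x. S b x \<partial>D) = (\<integral>x. g n x - S b x \<partial>D)" by simp
      also have "\<bar>\<dots>\<bar> \<le> (\<integral>x. \<bar>g n x - S b x\<bar> \<partial>D)" by (rule integral_abs_bound)
      also have "\<dots> \<le> (\<integral>x. e \<partial>D)"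
        by (rule integral_mono) (use approx in \<open>auto intro!: integrable_const_bound[where B = e]\<close>)
      finally show ?thesis by (simp add: prob_space)
    qed
    have "\<bar>(\<integral>x. S b x \<partial>P n) - (\<integral>x. S b x \<partial>R n)\<bar> \<le> C * (\<Sum>k. \<bar>a n k\<bar>)"
    proof -
      have le: "\<bar>b k * a n k\<bar> \<le> C * \<bar>a n k\<bar>" for k
        using b by (auto simp: abs_mult intro!: mult_right_mono)
      have s: "summable (\<lambda>k. \<bar>b k * a n k\<bar>)"
        by (rule summable_comparison_test'[OF summable_mult[OF summa], of 0]) (use le in auto)
      have "\<bar>\<Sum>k. b k * a n k\<bar> \<le> (\<Sum>k. \<bar>b k * a n k\<bar>)" by (rule summable_rabs[OF s])
      also have "\<dots> \<le> (\<Sum>k. C * \<bar>a n k\<bar>)"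
        by (rule suminf_le[OF le s summable_mult[OF summa]])
      finally show ?thesis using asums[of b C n, OF b] by (simp add: sums_iff suminf_mult[OF summa])
    qed
    then show ?thesis
      using N[OF that] approxD[OF P, of n] approxD[OF R, of n] \<open>0 < e0\<close>
      unfolding e_def real_norm_def diff_zero by linarith
  qed
  then show "\<exists>no. \<forall>n\<ge>no. norm ((\<integral>x. g n x \<partial>P n) - (\<integral>x. g n x \<partial>R n) - 0) < e0" by blast
qed

section \<open>Disintegration along kernels\<close>

text \<open>The hypothesis \<open>eq\<close> factorises the joint law on rectangles only. Rectangles
  form an intersection-stable generator, so the law of \<open>(U, V)\<close> equals the mixture of
  the measures \<open>K \<omega>\<close>, each the product of a point mass at
  \<open>U \<omega>\<close> with \<open>\<kappa> (U \<omega>)\<close>. Integrating against this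
  mixture gives the iterated integral.\<close>

lemma nn_integral_disintegration:
  assumes M: "prob_space M"
    and U[measurable]: "U \<in> M \<rightarrow>\<^sub>M N" and V[measurable]: "V \<in> M \<rightarrow>\<^sub>M L"
    and \<kappa>: "\<kappa> \<in> N \<rightarrow>\<^sub>M prob_algebra L"
    and eq: "\<And>A B. A \<in> sets N \<Longrightarrow> B \<in> sets L \<Longrightarrow>
      measure M {\<omega>\<in>space M. U \<omega> \<in> A \<and> V \<omega> \<in> B} = (\<integral>\<omega>. indicator A (U \<omega>) * measure (\<kappa> (U \<omega>)) B \<partial>M)"
    and \<phi>[measurable]: "\<phi> \<in> borel_measurable (N \<Otimes>\<^sub>M L)"
  shows "(\<integral>\<^sup>+\<omega>. \<phi> (U \<omega>, V \<omega>) \<partial>M) = (\<integral>\<^sup>+\<omega>. (\<integral>\<^sup>+v. \<phi> (U \<omega>, v) \<partial>\<kappa> (U \<omega>)) \<partial>M)"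
proof -
  interpret prob_space M by fact
  have \<kappa>U: "(\<lambda>\<omega>. \<kappa> (U \<omega>)) \<in> M \<rightarrow>\<^sub>M prob_algebra L" using measurable_compose[OF U \<kappa>] .
  note \<kappa>U' = measurable_prob_algebraD[OF \<kappa>U]
  have \<kappa>p: "prob_space (\<kappa> (U \<omega>))" "sets (\<kappa> (U \<omega>)) = sets L" "U \<omega> \<in> space N" if "\<omega> \<in> space M" for \<omega>
    using measurable_space[OF \<kappa>U that] measurable_space[OF U that] by (auto simp: space_prob_algebra)
  define K where "K \<omega> = distr (\<kappa> (U \<omega>)) (N \<Otimes>\<^sub>M L) (Pair (U \<omega>))" for \<omega>
  have K: "K \<in> M \<rightarrow>\<^sub>M subprob_algebra (N \<Otimes>\<^sub>M L)"
    unfolding K_def by (rule measurable_distr2[OF _ \<kappa>U']) simp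
  have Pair[measurable]: "Pair (U \<omega>) \<in> \<kappa> (U \<omega>) \<rightarrow>\<^sub>M N \<Otimes>\<^sub>M L" if "\<omega> \<in> space M" for \<omega>
    using \<kappa>p[OF that] by (simp cong: measurable_cong_sets)
  let ?E = "{a \<times> b |a b. a \<in> sets N \<and> b \<in> sets L}"
  have "distr M (N \<Otimes>\<^sub>M L) (\<lambda>\<omega>. (U \<omega>, V \<omega>)) = M \<bind> K"
  proof (rule measure_eqI_generator_eq[where E = ?E and \<Omega> = "space N \<times> space L"
        and A = "\<lambda>_. space N \<times> space L"])
    show "Int_stable ?E" by (rule Int_stable_pair_measure_generator)
    show "?E \<subseteq> Pow (space N \<times> space L)" by (auto dest: sets.sets_into_space)
    show "sets (distr M (N \<Otimes>\<^sub>M L) (\<lambda>\<omega>. (U \<omega>, V \<omega>))) = sigma_sets (space N \<times> space L) ?E"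
      by (simp add: sets_pair_measure)
    show "sets (M \<bind> K) = sigma_sets (space N \<times> space L) ?E"
      using sets_bind[OF sets_kernel[OF K] not_empty] by (simp add: sets_pair_measure)
    show "emeasure (distr M (N \<Otimes>\<^sub>M L) (\<lambda>\<omega>. (U \<omega>, V \<omega>))) (space N \<times> space L) \<noteq> \<infinity>"
      by (subst emeasure_distr) auto
    show "emeasure (distr M (N \<Otimes>\<^sub>M L) (\<lambda>\<omega>. (U \<omega>, V \<omega>))) X = emeasure (M \<bind> K) X" if X: "X \<in> ?E" for X
    proof -
      from X obtain A B where X: "X = A \<times> B" and AB[measurable]: "A \<in> sets N" "B \<in> sets L" by auto
      have meas[measurable]: "(\<lambda>\<omega>. measure (\<kappa> (U \<omega>)) B) \<in> borel_measurable M"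
        using measurable_compose[OF \<kappa>U measurable_measure_prob_algebra[OF AB(2)]] .
      have int: "integrable M (\<lambda>\<omega>. indicator A (U \<omega>) * measure (\<kappa> (U \<omega>)) B)"
        by (rule integrable_const_bound[where B = 1])
          (auto intro!: AE_I2 mult_le_one prob_space.prob_le_1 \<kappa>p simp: indicator_def)
      have "emeasure (distr M (N \<Otimes>\<^sub>M L) (\<lambda>\<omega>. (U \<omega>, V \<omega>))) X
          = emeasure M {\<omega>\<in>space M. U \<omega> \<in> A \<and> V \<omega> \<in> B}"
        unfolding X by (subst emeasure_distr) (auto intro!: arg_cong[where f = "emeasure M"])
      also have "\<dots> = ennreal (\<integral>\<omega>. indicator A (U \<omega>) * measure (\<kappa> (U \<omega>)) B \<partial>M)"
        by (simp add: emeasure_eq_measure eq)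
      also have "\<dots> = (\<integral>\<^sup>+\<omega>. ennreal (indicator A (U \<omega>) * measure (\<kappa> (U \<omega>)) B) \<partial>M)"
        by (rule nn_integral_eq_integral[symmetric, OF int]) auto
      also have "\<dots> = (\<integral>\<^sup>+\<omega>. emeasure (K \<omega>) X \<partial>M)"
      proof (rule nn_integral_cong)
        fix \<omega> assume \<omega>: "\<omega> \<in> space M"
        interpret \<kappa>: prob_space "\<kappa> (U \<omega>)" by (rule \<kappa>p[OF \<omega>])
        have "space (\<kappa> (U \<omega>)) = space L" using \<kappa>p(2)[OF \<omega>] by (rule sets_eq_imp_space_eq)
        then have "Pair (U \<omega>) -` X \<inter> space (\<kappa> (U \<omega>)) = (if U \<omega> \<in> A then B else {})"
          using sets.sets_into_space[OF AB(2)] by (auto simp: X)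
        then show "ennreal (indicator A (U \<omega>) * measure (\<kappa> (U \<omega>)) B) = emeasure (K \<omega>) X"
          unfolding K_def using \<omega> by (subst emeasure_distr) (auto simp: X \<kappa>.emeasure_eq_measure)
      qed
      also have "\<dots> = emeasure (M \<bind> K) X"
        by (rule emeasure_bind[symmetric, OF not_empty K]) (simp add: X)
      finally show ?thesis .
    qed
  qed auto
  moreover have "(\<integral>\<^sup>+x. \<phi> x \<partial>distr M (N \<Otimes>\<^sub>M L) (\<lambda>\<omega>. (U \<omega>, V \<omega>))) = (\<integral>\<^sup>+\<omega>. \<phi> (U \<omega>, V \<omega>) \<partial>M)"
    by (rule nn_integral_distr) auto
  ultimately have "(\<integral>\<^sup>+\<omega>. \<phi> (U \<omega>, V \<omega>) \<partial>M) = (\<integral>\<^sup>+x. \<phi> x \<partial>(M \<bind> K))" by simp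
  also have "\<dots> = (\<integral>\<^sup>+\<omega>. (\<integral>\<^sup>+x. \<phi> x \<partial>K \<omega>) \<partial>M)"
    by (rule nn_integral_bind[OF \<phi> K])
  also have "\<dots> = (\<integral>\<^sup>+\<omega>. (\<integral>\<^sup>+v. \<phi> (U \<omega>, v) \<partial>\<kappa> (U \<omega>)) \<partial>M)"
    unfolding K_def by (intro nn_integral_cong nn_integral_distr) auto
  finally show ?thesis .
qed

lemma integral_disintegration:
  fixes \<phi> :: "_ \<Rightarrow> real"
  assumes M: "prob_space M"
    and U[measurable]: "U \<in> M \<rightarrow>\<^sub>M N" and V[measurable]: "V \<in> M \<rightarrow>\<^sub>M L"
    and \<kappa>: "\<kappa> \<in> N \<rightarrow>\<^sub>M prob_algebra L"
    and eq: "\<And>A B. A \<in> sets N \<Longrightarrow> B \<in> sets L \<Longrightarrow>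
      measure M {\<omega>\<in>space M. U \<omega> \<in> A \<and> V \<omega> \<in> B} = (\<integral>\<omega>. indicator A (U \<omega>) * measure (\<kappa> (U \<omega>)) B \<partial>M)"
    and \<phi>[measurable]: "\<phi> \<in> borel_measurable (N \<Otimes>\<^sub>M L)"
    and bound: "\<And>x. \<bar>\<phi> x\<bar> \<le> C"
  shows "(\<integral>\<omega>. \<phi> (U \<omega>, V \<omega>) \<partial>M) = (\<integral>\<omega>. (\<integral>v. \<phi> (U \<omega>, v) \<partial>\<kappa> (U \<omega>)) \<partial>M)"
    and "(\<lambda>u. \<integral>v. \<phi> (u, v) \<partial>\<kappa> u) \<in> borel_measurable N"
proof -
  interpret prob_space M by fact
  note \<kappa>' = measurable_prob_algebraD[OF \<kappa>]
  show meas[measurable]: "(\<lambda>u. \<integral>v. \<phi> (u, v) \<partial>\<kappa> u) \<in> borel_measurable N"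
  proof -
    \<comment> \<open>Pushing \<open>\<kappa> u\<close> forward along \<open>Pair u\<close> moves
      the dependence on \<open>u\<close> from the integrand into the kernel, so a fixed
      \<open>\<phi>\<close> is integrated against a measurable family of measures.\<close>
    have "(\<lambda>u. \<integral>x. \<phi> x \<partial>distr (\<kappa> u) (N \<Otimes>\<^sub>M L) (Pair u)) \<in> borel_measurable N"
      by (rule measurable_compose[OF measurable_distr2[OF _ \<kappa>'] integral_measurable_subprob_algebra]) simp_all
    then show ?thesis
    proof (rule measurable_cong[THEN iffD1, rotated])
      fix u assume u: "u \<in> space N"
      have "sets (\<kappa> u) = sets L" using measurable_space[OF \<kappa> u] by (simp add: space_prob_algebra)
      then show "(\<integral>x. \<phi> x \<partial>distr (\<kappa> u) (N \<Otimes>\<^sub>M L) (Pair u)) = (\<integral>v. \<phi> (u, v) \<partial>\<kappa> u)"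
        using u by (intro integral_distr) (auto cong: measurable_cong_sets)
    qed
  qed
  have \<kappa>i: "prob_space (\<kappa> u)" "(\<lambda>v. \<phi> (u, v)) \<in> borel_measurable (\<kappa> u)"
     "integrable (\<kappa> u) (\<lambda>v. \<phi> (u, v))" if u: "u \<in> space N" for u
  proof -
    have *: "sets (\<kappa> u) = sets L" "prob_space (\<kappa> u)"
      using measurable_space[OF \<kappa> u] by (auto simp: space_prob_algebra)
    interpret \<kappa>: prob_space "\<kappa> u" by fact
    show "prob_space (\<kappa> u)" by fact
    show m: "(\<lambda>v. \<phi> (u, v)) \<in> borel_measurable (\<kappa> u)"
      using u *(1) by (simp cong: measurable_cong_sets)
    show "integrable (\<kappa> u) (\<lambda>v. \<phi> (u, v))"
      by (rule \<kappa>.integrable_const_bound[where B = C]) (use m bound in auto)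
  qed
  have bound\<kappa>: "\<bar>\<integral>v. \<phi> (u, v) \<partial>\<kappa> u\<bar> \<le> C" if u: "u \<in> space N" for u
  proof -
    interpret \<kappa>: prob_space "\<kappa> u" by (rule \<kappa>i[OF u])
    have "\<bar>\<integral>v. \<phi> (u, v) \<partial>\<kappa> u\<bar> \<le> (\<integral>v. \<bar>\<phi> (u, v)\<bar> \<partial>\<kappa> u)" by (rule integral_abs_bound)
    also have "\<dots> \<le> (\<integral>v. C \<partial>\<kappa> u)"
      by (rule integral_mono) (use \<kappa>i[OF u] bound in auto)
    finally show ?thesis by (simp add: \<kappa>.prob_space)
  qed
  \<comment> \<open>Adding the constant \<open>C\<close> makes the integrand nonnegative, which
    reduces the claim to the version for nonnegative integrals; \<open>C\<close> cancels at the end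
    because all measures have mass 1.\<close>
  have nonneg: "0 \<le> \<phi> x + C" for x using bound[of x] by linarith
  have int1: "integrable M (\<lambda>\<omega>. \<phi> (U \<omega>, V \<omega>))"
    by (rule integrable_const_bound[where B = C]) (use bound in auto)
  have int2: "integrable M (\<lambda>\<omega>. \<integral>v. \<phi> (U \<omega>, v) \<partial>\<kappa> (U \<omega>))"
    by (rule integrable_const_bound[where B = C])
      (use bound\<kappa> measurable_space[OF U] in auto)
  have "ennreal (\<integral>\<omega>. \<phi> (U \<omega>, V \<omega>) + C \<partial>M) = (\<integral>\<^sup>+\<omega>. ennreal (\<phi> (U \<omega>, V \<omega>) + C) \<partial>M)"
    by (rule nn_integral_eq_integral[symmetric]) (use int1 nonneg in auto)
  also have "\<dots> = (\<integral>\<^sup>+\<omega>. (\<integral>\<^sup>+v. ennreal (\<phi> (U \<omega>, v) + C) \<partial>\<kappa> (U \<omega>)) \<partial>M)"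
    by (rule nn_integral_disintegration[OF M U V \<kappa> eq, where \<phi> = "\<lambda>x. ennreal (\<phi> x + C)"]) auto
  also have "\<dots> = (\<integral>\<^sup>+\<omega>. ennreal ((\<integral>v. \<phi> (U \<omega>, v) \<partial>\<kappa> (U \<omega>)) + C) \<partial>M)"
  proof (rule nn_integral_cong)
    fix \<omega> assume "\<omega> \<in> space M"
    then have u: "U \<omega> \<in> space N" using measurable_space[OF U] by auto
    interpret \<kappa>: prob_space "\<kappa> (U \<omega>)" by (rule \<kappa>i[OF u])
    have "(\<integral>\<^sup>+v. ennreal (\<phi> (U \<omega>, v) + C) \<partial>\<kappa> (U \<omega>)) = ennreal (\<integral>v. \<phi> (U \<omega>, v) + C \<partial>\<kappa> (U \<omega>))"
      by (rule nn_integral_eq_integral) (use \<kappa>i[OF u] nonneg in auto)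
    then show "(\<integral>\<^sup>+v. ennreal (\<phi> (U \<omega>, v) + C) \<partial>\<kappa> (U \<omega>)) = ennreal ((\<integral>v. \<phi> (U \<omega>, v) \<partial>\<kappa> (U \<omega>)) + C)"
      using \<kappa>i[OF u] by (simp add: \<kappa>.prob_space)
  qed
  also have "\<dots> = ennreal (\<integral>\<omega>. (\<integral>v. \<phi> (U \<omega>, v) \<partial>\<kappa> (U \<omega>)) + C \<partial>M)"
  proof (rule nn_integral_eq_integral)
    show "AE \<omega> in M. 0 \<le> (\<integral>v. \<phi> (U \<omega>, v) \<partial>\<kappa> (U \<omega>)) + C"
      using bound\<kappa> measurable_space[OF U] by (intro AE_I2) (force simp: abs_le_iff)
  qed (use int2 in auto)
  finally have "(\<integral>\<omega>. \<phi> (U \<omega>, V \<omega>) + C \<partial>M) = (\<integral>\<omega>. (\<integral>v. \<phi> (U \<omega>, v) \<partial>\<kappa> (U \<omega>)) + C \<partial>M)"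
  proof (rule ennreal_inj[THEN iffD1, rotated 2])
    show "0 \<le> (\<integral>\<omega>. \<phi> (U \<omega>, V \<omega>) + C \<partial>M)" using nonneg by simp
    show "0 \<le> (\<integral>\<omega>. (\<integral>v. \<phi> (U \<omega>, v) \<partial>\<kappa> (U \<omega>)) + C \<partial>M)"
      using bound\<kappa> measurable_space[OF U] by (intro integral_nonneg_AE AE_I2) (force simp: abs_le_iff)
  qed
  then show "(\<integral>\<omega>. \<phi> (U \<omega>, V \<omega>) \<partial>M) = (\<integral>\<omega>. (\<integral>v. \<phi> (U \<omega>, v) \<partial>\<kappa> (U \<omega>)) \<partial>M)"
    using int1 int2 by (simp add: prob_space)
qed

text \<open>With a common kernel, both joint laws give \<open>E\<close> the integral of the same
  function \<open>\<psi> u\<close>, the \<open>\<kappa> u\<close>-mass of the section of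
  \<open>E\<close> at \<open>u\<close>. Being null thus means \<open>\<psi> = 0\<close> almost
  everywhere for the first marginal, and this passes from one marginal to the other.\<close>

lemma absolutely_continuous_transfer_kernel:
  assumes M1: "prob_space M1" and M2: "prob_space M2"
    and U1: "U1 \<in> M1 \<rightarrow>\<^sub>M N" and V1: "V1 \<in> M1 \<rightarrow>\<^sub>M L"
    and U2: "U2 \<in> M2 \<rightarrow>\<^sub>M N" and V2: "V2 \<in> M2 \<rightarrow>\<^sub>M L"
    and \<kappa>: "\<kappa> \<in> N \<rightarrow>\<^sub>M prob_algebra L"
    and eq1: "\<And>A B. A \<in> sets N \<Longrightarrow> B \<in> sets L \<Longrightarrow>
      measure M1 {\<omega>\<in>space M1. U1 \<omega> \<in> A \<and> V1 \<omega> \<in> B} = (\<integral>\<omega>. indicator A (U1 \<omega>) * measure (\<kappa> (U1 \<omega>)) B \<partial>M1)"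
    and eq2: "\<And>A B. A \<in> sets N \<Longrightarrow> B \<in> sets L \<Longrightarrow>
      measure M2 {\<omega>\<in>space M2. U2 \<omega> \<in> A \<and> V2 \<omega> \<in> B} = (\<integral>\<omega>. indicator A (U2 \<omega>) * measure (\<kappa> (U2 \<omega>)) B \<partial>M2)"
    and ac: "absolutely_continuous (distr M2 N U2) (distr M1 N U1)"
  shows "absolutely_continuous (distr M2 (N \<Otimes>\<^sub>M L) (\<lambda>\<omega>. (U2 \<omega>, V2 \<omega>))) (distr M1 (N \<Otimes>\<^sub>M L) (\<lambda>\<omega>. (U1 \<omega>, V1 \<omega>)))"
  unfolding absolutely_continuous_def
proof
  fix E assume E': "E \<in> null_sets (distr M2 (N \<Otimes>\<^sub>M L) (\<lambda>\<omega>. (U2 \<omega>, V2 \<omega>)))"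
  then have E[measurable]: "E \<in> sets (N \<Otimes>\<^sub>M L)" by (auto simp: null_sets_def)
  define \<psi> where "\<psi> u = (\<integral>\<^sup>+v. indicator E (u, v) \<partial>\<kappa> u)" for u
  have \<psi>: "\<psi> \<in> borel_measurable N"
    unfolding \<psi>_def by (rule nn_integral_measurable_subprob_algebra2[OF _ measurable_prob_algebraD[OF \<kappa>]]) measurable
  have eq: "emeasure (distr M (N \<Otimes>\<^sub>M L) (\<lambda>\<omega>. (U \<omega>, V \<omega>))) E = (\<integral>\<^sup>+u. \<psi> u \<partial>distr M N U)"
    if "prob_space M" and U[measurable]: "U \<in> M \<rightarrow>\<^sub>M N" and V[measurable]: "V \<in> M \<rightarrow>\<^sub>M L"
    and eq: "\<And>A B. A \<in> sets N \<Longrightarrow> B \<in> sets L \<Longrightarrow>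
      measure M {\<omega>\<in>space M. U \<omega> \<in> A \<and> V \<omega> \<in> B} = (\<integral>\<omega>. indicator A (U \<omega>) * measure (\<kappa> (U \<omega>)) B \<partial>M)"
    for M :: "'e measure" and U V
  proof -
    have "emeasure (distr M (N \<Otimes>\<^sub>M L) (\<lambda>\<omega>. (U \<omega>, V \<omega>))) E
        = (\<integral>\<^sup>+x. indicator E x \<partial>distr M (N \<Otimes>\<^sub>M L) (\<lambda>\<omega>. (U \<omega>, V \<omega>)))" by simp
    also have "\<dots> = (\<integral>\<^sup>+\<omega>. indicator E (U \<omega>, V \<omega>) \<partial>M)" by (rule nn_integral_distr) auto
    also have "\<dots> = (\<integral>\<^sup>+\<omega>. \<psi> (U \<omega>) \<partial>M)"
      unfolding \<psi>_def by (rule nn_integral_disintegration[OF that(1) U V \<kappa> eq]) auto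
    also have "\<dots> = (\<integral>\<^sup>+u. \<psi> u \<partial>distr M N U)"
      by (rule nn_integral_distr[symmetric]) (use \<psi> in auto)
    finally show ?thesis .
  qed
  have "emeasure (distr M2 (N \<Otimes>\<^sub>M L) (\<lambda>\<omega>. (U2 \<omega>, V2 \<omega>))) E = (\<integral>\<^sup>+u. \<psi> u \<partial>distr M2 N U2)"
    by (rule eq[OF M2 U2 V2 eq2])
  with E' have "(\<integral>\<^sup>+u. \<psi> u \<partial>distr M2 N U2) = 0" by (simp add: null_sets_def)
  then have "AE u in distr M2 N U2. \<psi> u = 0"
    by (subst (asm) nn_integral_0_iff_AE) (use \<psi> in auto)
  then have "AE u in distr M1 N U1. \<psi> u = 0"
    by (rule absolutely_continuous_AE[OF _ ac, rotated]) simp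
  then have "(\<integral>\<^sup>+u. \<psi> u \<partial>distr M1 N U1) = 0"
    by (subst nn_integral_0_iff_AE) (use \<psi> in auto)
  moreover have "emeasure (distr M1 (N \<Otimes>\<^sub>M L) (\<lambda>\<omega>. (U1 \<omega>, V1 \<omega>))) E = (\<integral>\<^sup>+u. \<psi> u \<partial>distr M1 N U1)"
    by (rule eq[OF M1 U1 V1 eq1])
  ultimately have "emeasure (distr M1 (N \<Otimes>\<^sub>M L) (\<lambda>\<omega>. (U1 \<omega>, V1 \<omega>))) E = 0" by simp
  then show "E \<in> null_sets (distr M1 (N \<Otimes>\<^sub>M L) (\<lambda>\<omega>. (U1 \<omega>, V1 \<omega>)))"
    by (auto simp: null_sets_def)
qed

lemma absolutely_continuous_distr_compose:
  assumes ac: "absolutely_continuous (distr M2 N U2) (distr M1 N U1)"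
    and U1: "U1 \<in> M1 \<rightarrow>\<^sub>M N" and U2: "U2 \<in> M2 \<rightarrow>\<^sub>M N" and g: "g \<in> N \<rightarrow>\<^sub>M L"
  shows "absolutely_continuous (distr M2 L (\<lambda>\<omega>. g (U2 \<omega>))) (distr M1 L (\<lambda>\<omega>. g (U1 \<omega>)))"
  unfolding absolutely_continuous_def
proof
  fix E assume E: "E \<in> null_sets (distr M2 L (\<lambda>\<omega>. g (U2 \<omega>)))"
  then have E': "E \<in> sets L" by (auto simp: null_sets_def)
  have gE: "g -` E \<inter> space N \<in> sets N" using measurable_sets[OF g E'] .
  have eq: "emeasure (distr M L (\<lambda>\<omega>. g (U \<omega>))) E = emeasure (distr M N U) (g -` E \<inter> space N)"
    if "U \<in> M \<rightarrow>\<^sub>M N" for M :: "'e measure" and U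
    using distr_distr[OF g that] emeasure_distr[of g "distr M N U" L E] g E' by (simp add: comp_def)
  have "g -` E \<inter> space N \<in> null_sets (distr M2 N U2)"
    using E eq[OF U2] gE by (auto simp: null_sets_def)
  then have "g -` E \<inter> space N \<in> null_sets (distr M1 N U1)"
    using ac by (auto simp: absolutely_continuous_def)
  then show "E \<in> null_sets (distr M1 L (\<lambda>\<omega>. g (U1 \<omega>)))"
    using eq[OF U1] E' by (auto simp: null_sets_def)
qed

section \<open>Hidden Markov models\<close>

context
  fixes M :: "'w measure" and \<mu> :: "'x::polish_space measure" and T Q
    and X :: "nat \<Rightarrow> 'w \<Rightarrow> 'x" and Z :: "nat \<Rightarrow> 'w \<Rightarrow> 'z::polish_space"
  assumes HMM: "HMM M \<mu> T Q X Z"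
begin

lemma HMM_prob_space: "prob_space M"
  and HMM_measurable_X: "X n \<in> borel_measurable M"
  and HMM_measurable_Z: "Z n \<in> borel_measurable M"
  and HMM_distr_X0: "distr M borel (X 0) = \<mu>"
  and HMM_distr_Z: "distr M borel (Z n) = Q"
  using HMM by (auto simp: HMM_def)

lemma HMM_restrict_X_measurable: "(\<lambda>\<omega>. \<lambda>i\<in>I. X i \<omega>) \<in> M \<rightarrow>\<^sub>M PiM I (\<lambda>_. borel)"
  and HMM_restrict_Z_measurable: "(\<lambda>\<omega>. \<lambda>i\<in>I. Z i \<omega>) \<in> M \<rightarrow>\<^sub>M PiM I (\<lambda>_. borel)"
  using HMM_measurable_X HMM_measurable_Z by (auto intro!: measurable_restrict)

lemma HMM_transition:
  assumes T: "T \<in> borel \<rightarrow>\<^sub>M prob_algebra borel"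
    and B[measurable]: "B \<in> sets (PiM {..n} (\<lambda>_. borel))" and A[measurable]: "A \<in> sets borel"
  shows "measure M {\<omega>\<in>space M. (\<lambda>i\<in>{..n}. X i \<omega>) \<in> B \<and> X (Suc n) \<omega> \<in> A}
    = (\<integral>\<omega>. indicator B (\<lambda>i\<in>{..n}. X i \<omega>) * measure (T (X n \<omega>)) A \<partial>M)"
proof -
  interpret prob_space M by (rule HMM_prob_space)
  note [measurable] = HMM_measurable_X HMM_restrict_X_measurable
  let ?P = "PiM {..n} (\<lambda>_. borel :: 'x measure)" and ?U = "\<lambda>\<omega>. \<lambda>i\<in>{..n}. X i \<omega>"
  have TX: "(\<lambda>\<omega>. T (X n \<omega>)) \<in> M \<rightarrow>\<^sub>M prob_algebra borel" by (rule measurable_compose[OF _ T]) simp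
  have Tm[measurable]: "(\<lambda>\<omega>. measure (T (X n \<omega>)) A) \<in> borel_measurable M"
    by (rule measurable_compose[OF TX]) simp
  have T1: "measure (T (X n \<omega>)) A \<le> 1" if "\<omega> \<in> space M" for \<omega>
    using measurable_space[OF TX that] by (auto simp: space_prob_algebra intro: prob_space.prob_le_1)
  define m1 where "m1 = distr (density M (\<lambda>\<omega>. indicator A (X (Suc n) \<omega>))) ?P ?U"
  define m2 where "m2 = distr (density M (\<lambda>\<omega>. ennreal (measure (T (X n \<omega>)) A))) ?P ?U"
  have e1: "emeasure m1 B = ennreal (measure M {\<omega>\<in>space M. ?U \<omega> \<in> B \<and> X (Suc n) \<omega> \<in> A})"
    if [measurable]: "B \<in> sets ?P" for B
  proof -
    have "emeasure m1 B = (\<integral>\<^sup>+\<omega>. indicator A (X (Suc n) \<omega>) * indicator (?U -` B \<inter> space M) \<omega> \<partial>M)"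
      unfolding m1_def by (subst emeasure_distr, simp, simp, subst emeasure_density) auto
    also have "\<dots> = (\<integral>\<^sup>+\<omega>. indicator {\<omega>\<in>space M. ?U \<omega> \<in> B \<and> X (Suc n) \<omega> \<in> A} \<omega> \<partial>M)"
      by (intro nn_integral_cong) (auto simp: indicator_def)
    finally have "emeasure m1 B = \<dots>" .
    then show ?thesis by (simp add: emeasure_eq_measure)
  qed
  have e2: "emeasure m2 B = ennreal (\<integral>\<omega>. indicator B (?U \<omega>) * measure (T (X n \<omega>)) A \<partial>M)"
    if [measurable]: "B \<in> sets ?P" for B
  proof -
    have "emeasure m2 B = (\<integral>\<^sup>+\<omega>. ennreal (indicator B (?U \<omega>) * measure (T (X n \<omega>)) A) \<partial>M)"
      unfolding m2_def by (subst emeasure_distr, simp, simp, subst emeasure_density)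
        (auto intro!: nn_integral_cong simp: indicator_def)
    also have "\<dots> = ennreal (\<integral>\<omega>. indicator B (?U \<omega>) * measure (T (X n \<omega>)) A \<partial>M)"
      by (rule nn_integral_eq_integral)
        (auto intro!: integrable_const_bound[where B = 1] mult_le_one T1 simp: indicator_def)
    finally show ?thesis .
  qed
  have "m1 = m2"
  proof (rule measure_eqI_PiM_finite[where I = "{..n}" and M = "\<lambda>_. borel" and A = "\<lambda>_. space ?P"])
    fix A' :: "nat \<Rightarrow> 'x set" assume A': "\<And>i. i \<in> {..n} \<Longrightarrow> A' i \<in> sets borel"
    define C where "C i = (if i \<le> n then A' i else A)" for i
    have C: "\<forall>i. C i \<in> sets borel" using A' by (simp add: C_def)
    have box: "Pi\<^sub>E {..n} A' \<in> sets ?P" using A' by (intro sets_PiM_I_finite) auto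
    have U: "?U \<omega> \<in> Pi\<^sub>E {..n} A' \<longleftrightarrow> (\<forall>i\<le>n. X i \<omega> \<in> C i)" for \<omega>
      by (auto simp: C_def PiE_iff)
    have "measure M {\<omega>\<in>space M. \<forall>i\<le>Suc n. X i \<omega> \<in> C i} =
        (\<integral>\<omega>. indicator {\<omega>\<in>space M. \<forall>i\<le>n. X i \<omega> \<in> C i} \<omega> * measure (T (X n \<omega>)) (C (Suc n)) \<partial>M)"
      using HMM C unfolding HMM_def by blast
    also have "{\<omega>\<in>space M. \<forall>i\<le>Suc n. X i \<omega> \<in> C i} = {\<omega>\<in>space M. ?U \<omega> \<in> Pi\<^sub>E {..n} A' \<and> X (Suc n) \<omega> \<in> A}"
      unfolding U by (auto simp: le_Suc_eq C_def)
    also have "(\<integral>\<omega>. indicator {\<omega>\<in>space M. \<forall>i\<le>n. X i \<omega> \<in> C i} \<omega> * measure (T (X n \<omega>)) (C (Suc n)) \<partial>M)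
        = (\<integral>\<omega>. indicator (Pi\<^sub>E {..n} A') (?U \<omega>) * measure (T (X n \<omega>)) A \<partial>M)"
    proof (rule Bochner_Integration.integral_cong[OF refl])
      fix \<omega> assume "\<omega> \<in> space M"
      then have "indicator {\<omega>\<in>space M. \<forall>i\<le>n. X i \<omega> \<in> C i} \<omega> = (indicator (Pi\<^sub>E {..n} A') (?U \<omega>) :: real)"
        unfolding indicator_def U mem_Collect_eq by simp
      then show "indicator {\<omega>\<in>space M. \<forall>i\<le>n. X i \<omega> \<in> C i} \<omega> * measure (T (X n \<omega>)) (C (Suc n))
          = indicator (Pi\<^sub>E {..n} A') (?U \<omega>) * measure (T (X n \<omega>)) A"
        by (simp only:) (simp add: C_def)
    qed
    finally show "emeasure m1 (Pi\<^sub>E {..n} A') = emeasure m2 (Pi\<^sub>E {..n} A')"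
      unfolding e1[OF box] e2[OF box] by simp
  next
    show "range (\<lambda>_. space ?P) \<subseteq> prod_algebra {..n} (\<lambda>_. borel :: 'x measure)"
      unfolding space_PiM by (auto intro!: prod_algebraI_finite simp: space_in_borel)
    show "emeasure m1 (space ?P) \<noteq> \<infinity>" by (subst e1) auto
  qed (auto simp: m1_def m2_def)
  then have "ennreal (measure M {\<omega>\<in>space M. ?U \<omega> \<in> B \<and> X (Suc n) \<omega> \<in> A})
      = ennreal (\<integral>\<omega>. indicator B (?U \<omega>) * measure (T (X n \<omega>)) A \<partial>M)"
    using e1[OF B] e2[OF B] by simp
  then show ?thesis by (subst (asm) ennreal_inj) auto
qed

text \<open>Independence is assumed for the sigma-algebras of the full sequences; events about
  selected coordinates are pulled back to these along restriction maps.\<close>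

lemma HMM_indep_XZ:
  assumes B: "B \<in> sets (PiM I (\<lambda>_. borel))" and C: "C \<in> sets (PiM J (\<lambda>_. borel))"
  shows "measure M {\<omega>\<in>space M. (\<lambda>i\<in>I. X i \<omega>) \<in> B \<and> (\<lambda>i\<in>J. Z i \<omega>) \<in> C}
    = measure M {\<omega>\<in>space M. (\<lambda>i\<in>I. X i \<omega>) \<in> B} * measure M {\<omega>\<in>space M. (\<lambda>i\<in>J. Z i \<omega>) \<in> C}"
proof -
  interpret prob_space M by (rule HMM_prob_space)
  have sets: "{\<omega>\<in>space M. (\<lambda>i\<in>I. W i \<omega>) \<in> B}
      \<in> sets (vimage_algebra (space M) (\<lambda>\<omega> i. W i \<omega>) (PiM UNIV (\<lambda>_. borel)))"
    if "B \<in> sets (PiM I (\<lambda>_. borel))" for I B and W :: "nat \<Rightarrow> 'w \<Rightarrow> 'b::topological_space"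
  proof -
    have "(\<lambda>w. restrict w I) -` B \<inter> space (PiM UNIV (\<lambda>_. borel :: 'b measure)) \<in> sets (PiM UNIV (\<lambda>_. borel))"
      by (rule measurable_sets[OF measurable_restrict_subset that]) simp
    from in_vimage_algebra[OF this, of "\<lambda>\<omega> i. W i \<omega>" "space M"] show ?thesis
      by (rule arg_cong[THEN iffD1, rotated]) (auto simp: space_PiM restrict_def)
  qed
  have "indep_set
        (sets (vimage_algebra (space M) (\<lambda>\<omega> i. X i \<omega>) (PiM UNIV (\<lambda>_. borel))))
        (sets (vimage_algebra (space M) (\<lambda>\<omega> i. Z i \<omega>) (PiM UNIV (\<lambda>_. borel))))"
    using HMM by (simp add: HMM_def)
  from indep_setD[OF this sets[OF B, of X] sets[OF C, of Z]] show ?thesis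
    by (simp add: Collect_conj_eq[symmetric] Int_def conj_ac cong: conj_cong)
qed

lemma HMM_distr_restrict_Z:
  assumes "I \<noteq> {}"
  shows "distr M (PiM I (\<lambda>_. borel)) (\<lambda>\<omega>. \<lambda>i\<in>I. Z i \<omega>) = PiM I (\<lambda>_. Q)"
proof -
  interpret prob_space M by (rule HMM_prob_space)
  have "indep_vars (\<lambda>_. borel) Z UNIV" using HMM by (simp add: HMM_def)
  then have "indep_vars (\<lambda>_. borel) Z I" by (rule indep_vars_subset) simp
  then show ?thesis
    using indep_vars_iff_distr_eq_PiM'[OF assms, where M' = "\<lambda>_. borel" and X = Z] HMM_measurable_Z by (simp add: HMM_distr_Z)
qed

text \<open>Independence is disintegration along a constant kernel. The inner variable
  \<open>\<omega>'\<close> plays the part of an independent copy of the noise, so the states can be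
  frozen while the noise is integrated.\<close>

lemma HMM_nn_integral_XZ:
  assumes \<phi>[measurable]: "\<phi> \<in> borel_measurable (PiM I (\<lambda>_. borel) \<Otimes>\<^sub>M PiM J (\<lambda>_. borel))"
  shows "(\<integral>\<^sup>+\<omega>. \<phi> ((\<lambda>i\<in>I. X i \<omega>), (\<lambda>i\<in>J. Z i \<omega>)) \<partial>M)
    = (\<integral>\<^sup>+\<omega>. (\<integral>\<^sup>+\<omega>'. \<phi> ((\<lambda>i\<in>I. X i \<omega>), (\<lambda>i\<in>J. Z i \<omega>')) \<partial>M) \<partial>M)"
proof -
  interpret prob_space M by (rule HMM_prob_space)
  note [measurable] = HMM_restrict_X_measurable HMM_restrict_Z_measurable
  let ?U = "\<lambda>\<omega>. \<lambda>i\<in>I. X i \<omega>" and ?V = "\<lambda>\<omega>. \<lambda>i\<in>J. Z i \<omega>"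
  let ?D = "distr M (PiM J (\<lambda>_. borel)) ?V"
  have D: "?D \<in> space (prob_algebra (PiM J (\<lambda>_. borel)))"
    by (auto simp: space_prob_algebra intro!: prob_space_distr)
  have "(\<integral>\<^sup>+\<omega>. \<phi> (?U \<omega>, ?V \<omega>) \<partial>M) = (\<integral>\<^sup>+\<omega>. (\<integral>\<^sup>+z. \<phi> (?U \<omega>, z) \<partial>?D) \<partial>M)"
  proof (rule nn_integral_disintegration[where \<kappa> = "\<lambda>_. ?D" and N = "PiM I (\<lambda>_. borel)"])
    show "prob_space M" by (rule HMM_prob_space)
    show "(\<lambda>_. ?D) \<in> PiM I (\<lambda>_. borel) \<rightarrow>\<^sub>M prob_algebra (PiM J (\<lambda>_. borel))"
      using D by simp
    fix A B assume [measurable]: "A \<in> sets (PiM I (\<lambda>_. borel :: 'x measure))" "B \<in> sets (PiM J (\<lambda>_. borel :: 'z measure))"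
    have "(\<integral>\<omega>. indicator A (?U \<omega>) * measure ?D B \<partial>M) = (\<integral>\<omega>. indicator {\<omega>\<in>space M. ?U \<omega> \<in> A} \<omega> \<partial>M) * measure ?D B"
      by (simp add: indicator_def cong: Bochner_Integration.integral_cong)
    also have "\<dots> = measure M {\<omega>\<in>space M. ?U \<omega> \<in> A} * measure M {\<omega>\<in>space M. ?V \<omega> \<in> B}"
      by (simp add: measure_distr vimage_def Int_def conj_commute)
    also have "\<dots> = measure M {\<omega>\<in>space M. ?U \<omega> \<in> A \<and> ?V \<omega> \<in> B}"
      by (rule HMM_indep_XZ[symmetric]) auto
    finally show "measure M {\<omega>\<in>space M. ?U \<omega> \<in> A \<and> ?V \<omega> \<in> B}
      = (\<integral>\<omega>. indicator A (?U \<omega>) * measure ?D B \<partial>M)" ..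
  qed measurable
  also have "\<dots> = (\<integral>\<^sup>+\<omega>. (\<integral>\<^sup>+\<omega>'. \<phi> (?U \<omega>, ?V \<omega>') \<partial>M) \<partial>M)"
  proof (rule nn_integral_cong)
    fix \<omega> assume "\<omega> \<in> space M"
    then have [measurable]: "?U \<omega> \<in> space (PiM I (\<lambda>_. borel))" by (simp add: space_PiM)
    show "(\<integral>\<^sup>+z. \<phi> (?U \<omega>, z) \<partial>?D) = (\<integral>\<^sup>+\<omega>'. \<phi> (?U \<omega>, ?V \<omega>') \<partial>M)"
      by (rule nn_integral_distr) measurable
  qed
  finally show ?thesis .
qed

text \<open>Two independences are combined: states from noise, and \<open>Z n\<close> from the
  earlier noise. With the states frozen, \<open>G\<close> becomes an event \<open>B\<close> about
  the earlier noise alone, from which \<open>Z n\<close> splits off; afterwards the states are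
  released again. The index sets are those on which the observations before \<open>n\<close> and the
  state \<open>X n\<close> depend.\<close>

lemma HMM_indep_future_noise:
  assumes G[measurable]: "G \<in> sets (PiM {..n} (\<lambda>_. borel) \<Otimes>\<^sub>M PiM {..<n} (\<lambda>_. borel))" and C[measurable]: "C \<in> sets borel"
  shows "measure M {\<omega>\<in>space M. ((\<lambda>i\<in>{..n}. X i \<omega>), (\<lambda>i\<in>{..<n}. Z i \<omega>)) \<in> G \<and> Z n \<omega> \<in> C}
    = measure M {\<omega>\<in>space M. ((\<lambda>i\<in>{..n}. X i \<omega>), (\<lambda>i\<in>{..<n}. Z i \<omega>)) \<in> G} * measure Q C"
proof -
  interpret prob_space M by (rule HMM_prob_space)
  note [measurable] = HMM_measurable_X HMM_restrict_X_measurable HMM_measurable_Z HMM_restrict_Z_measurable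
  let ?PX = "PiM {..n} (\<lambda>_. borel :: 'x measure)" and ?PZ = "PiM {..<n} (\<lambda>_. borel :: 'z measure)"
  let ?U = "\<lambda>\<omega>. \<lambda>i\<in>{..n}. X i \<omega>" and ?V = "\<lambda>\<omega>. \<lambda>i\<in>{..<n}. Z i \<omega>"
  have indZ: "measure M {\<omega>\<in>space M. ?V \<omega> \<in> B \<and> Z n \<omega> \<in> C} = measure M {\<omega>\<in>space M. ?V \<omega> \<in> B} * measure Q C"
    if [measurable]: "B \<in> sets ?PZ" for B
  proof -
    have "indep_vars (\<lambda>_. borel) Z UNIV" using HMM by (simp add: HMM_def)
    from indep_var_restrict[OF this, of "{..<n}" "{n}"]
    have iv: "indep_var ?PZ ?V (PiM {n} (\<lambda>_. borel)) (\<lambda>\<omega>. \<lambda>i\<in>{n}. Z i \<omega>)" by auto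
    have C': "(\<lambda>z. z n) -` C \<inter> space (PiM {n} (\<lambda>_. borel :: 'z measure)) \<in> sets (PiM {n} (\<lambda>_. borel))"
      by measurable
    have "measure Q C = measure M {\<omega>\<in>space M. Z n \<omega> \<in> C}"
      unfolding HMM_distr_Z[of n, symmetric]
      by (subst measure_distr) (auto intro!: arg_cong[where f = prob])
    also have "{\<omega>\<in>space M. Z n \<omega> \<in> C}
        = (\<lambda>\<omega>. \<lambda>i\<in>{n}. Z i \<omega>) -` ((\<lambda>z. z n) -` C \<inter> space (PiM {n} (\<lambda>_. borel :: 'z measure))) \<inter> space M"
      by (auto simp: space_PiM)
    finally have "measure M {\<omega>\<in>space M. ?V \<omega> \<in> B} * measure Q C
       = prob ((\<lambda>\<omega>. (?V \<omega>, \<lambda>i\<in>{n}. Z i \<omega>)) -` (B \<times> ((\<lambda>z. z n) -` C \<inter> space (PiM {n} (\<lambda>_. borel :: 'z measure)))) \<inter> space M)"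
      using indep_varD[OF iv that C'] by (simp add: vimage_def Int_def conj_ac)
    also have "\<dots> = measure M {\<omega>\<in>space M. ?V \<omega> \<in> B \<and> Z n \<omega> \<in> C}"
      by (rule arg_cong[where f = prob]) (auto simp: space_PiM)
    finally show ?thesis ..
  qed
  \<comment> \<open>Earlier noise and \<open>Z n\<close> are read off one vector indexed by
    \<open>{..n}\<close>, so that states and noise are separated in a single application of
    \<open>HMM_nn_integral_XZ\<close>.\<close>
  define \<phi> :: "(nat \<Rightarrow> 'x) \<times> (nat \<Rightarrow> 'z) \<Rightarrow> ennreal"
    where "\<phi> = (\<lambda>(x, z). indicator G (x, restrict z {..<n}) * indicator C (z n))"
  have [measurable]: "(\<lambda>z. restrict z {..<n}) \<in> PiM {..n} (\<lambda>_. borel :: 'z measure) \<rightarrow>\<^sub>M ?PZ"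
    by (rule measurable_restrict_subset) auto
  have \<phi>[measurable]: "\<phi> \<in> borel_measurable (?PX \<Otimes>\<^sub>M PiM {..n} (\<lambda>_. borel))"
    unfolding \<phi>_def by measurable
  have \<phi>_eq: "\<phi> (x, \<lambda>i\<in>{..n}. Z i \<omega>) = indicator G (x, ?V \<omega>) * indicator C (Z n \<omega>)" for x \<omega>
    by (auto simp: \<phi>_def restrict_def fun_eq_iff intro!: arg_cong2[where f = "(*)"] arg_cong[where f = "indicator G"])
  have [measurable]: "{\<omega>\<in>space M. (?U \<omega>, ?V \<omega>) \<in> G} \<in> events" by measurable
  have "ennreal (measure M {\<omega>\<in>space M. (?U \<omega>, ?V \<omega>) \<in> G \<and> Z n \<omega> \<in> C})
      = (\<integral>\<^sup>+\<omega>. indicator {\<omega>\<in>space M. (?U \<omega>, ?V \<omega>) \<in> G \<and> Z n \<omega> \<in> C} \<omega> \<partial>M)"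
    by (simp add: emeasure_eq_measure)
  also have "\<dots> = (\<integral>\<^sup>+\<omega>. \<phi> (?U \<omega>, \<lambda>i\<in>{..n}. Z i \<omega>) \<partial>M)"
    unfolding \<phi>_eq by (intro nn_integral_cong) (auto simp: indicator_def)
  also have "\<dots> = (\<integral>\<^sup>+\<omega>. (\<integral>\<^sup>+\<omega>'. \<phi> (?U \<omega>, \<lambda>i\<in>{..n}. Z i \<omega>') \<partial>M) \<partial>M)"
    by (rule HMM_nn_integral_XZ) (rule \<phi>)
  also have "\<dots> = (\<integral>\<^sup>+\<omega>. (\<integral>\<^sup>+\<omega>'. indicator G (?U \<omega>, ?V \<omega>') \<partial>M) * ennreal (measure Q C) \<partial>M)"
  proof (rule nn_integral_cong)
    fix \<omega> assume "\<omega> \<in> space M"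
    define B where "B = Pair (?U \<omega>) -` G"
    have B: "B \<in> sets ?PZ" unfolding B_def by (rule sets_Pair1[OF G])
    have [measurable]: "{\<omega>'\<in>space M. ?V \<omega>' \<in> B} \<in> events"
       "{\<omega>'\<in>space M. ?V \<omega>' \<in> B \<and> Z n \<omega>' \<in> C} \<in> events" using B by measurable
    have "(\<integral>\<^sup>+\<omega>'. \<phi> (?U \<omega>, \<lambda>i\<in>{..n}. Z i \<omega>') \<partial>M)
        = (\<integral>\<^sup>+\<omega>'. indicator {\<omega>'\<in>space M. ?V \<omega>' \<in> B \<and> Z n \<omega>' \<in> C} \<omega>' \<partial>M)"
      unfolding \<phi>_eq by (intro nn_integral_cong) (auto simp: indicator_def B_def)
    also have "\<dots> = ennreal (measure M {\<omega>'\<in>space M. ?V \<omega>' \<in> B}) * ennreal (measure Q C)"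
      by (simp add: emeasure_eq_measure indZ[OF B] ennreal_mult)
    also have "ennreal (measure M {\<omega>'\<in>space M. ?V \<omega>' \<in> B}) = (\<integral>\<^sup>+\<omega>'. indicator {\<omega>'\<in>space M. ?V \<omega>' \<in> B} \<omega>' \<partial>M)"
      by (simp add: emeasure_eq_measure)
    also have "\<dots> = (\<integral>\<^sup>+\<omega>'. indicator G (?U \<omega>, ?V \<omega>') \<partial>M)"
      by (intro nn_integral_cong) (auto simp: indicator_def B_def)
    finally show "(\<integral>\<^sup>+\<omega>'. \<phi> (?U \<omega>, \<lambda>i\<in>{..n}. Z i \<omega>') \<partial>M)
        = (\<integral>\<^sup>+\<omega>'. indicator G (?U \<omega>, ?V \<omega>') \<partial>M) * ennreal (measure Q C)" .
  qed
  also have "\<dots> = (\<integral>\<^sup>+\<omega>. (\<integral>\<^sup>+\<omega>'. indicator G (?U \<omega>, ?V \<omega>') \<partial>M) \<partial>M) * ennreal (measure Q C)"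
    by (rule nn_integral_multc) measurable
  also have "(\<integral>\<^sup>+\<omega>. (\<integral>\<^sup>+\<omega>'. indicator G (?U \<omega>, ?V \<omega>') \<partial>M) \<partial>M) = (\<integral>\<^sup>+\<omega>. indicator G (?U \<omega>, ?V \<omega>) \<partial>M)"
    by (rule HMM_nn_integral_XZ[symmetric]) measurable
  also have "\<dots> = (\<integral>\<^sup>+\<omega>. indicator {\<omega>\<in>space M. (?U \<omega>, ?V \<omega>) \<in> G} \<omega> \<partial>M)"
    by (intro nn_integral_cong) (auto simp: indicator_def)
  also have "\<dots> * ennreal (measure Q C) = ennreal (measure M {\<omega>\<in>space M. (?U \<omega>, ?V \<omega>) \<in> G} * measure Q C)"
    by (simp add: emeasure_eq_measure ennreal_mult)
  finally show ?thesis by (subst (asm) ennreal_inj) auto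
qed

end

section \<open>Observation records and absolute continuity of their laws\<close>

lemma obs_measurable:
  assumes h: "h \<in> borel_measurable (borel \<Otimes>\<^sub>M borel)"
    and X: "\<And>i. X i \<in> borel_measurable M" and Z: "\<And>i. Z i \<in> borel_measurable M"
  shows "obs h X Z I \<in> M \<rightarrow>\<^sub>M PiM I (\<lambda>_. borel)"
proof -
  have "(\<lambda>\<omega>. h (X i \<omega>, Z i \<omega>)) \<in> borel_measurable M" for i
    by (rule measurable_compose[OF measurable_Pair[OF X Z] h])
  then show ?thesis unfolding obs_def[abs_def] by (intro measurable_restrict)
qed

lemma obs_atMost: "obs h X Z {..n} \<omega> = (obs h X Z {..<n} \<omega>)(n := h (X n \<omega>, Z n \<omega>))"
  by (auto simp: obs_def fun_eq_iff)

lemma obs_map_measurable: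
  assumes h: "h \<in> borel_measurable (borel \<Otimes>\<^sub>M borel)" and "I \<subseteq> J" "I \<subseteq> K"
  shows "(\<lambda>(x, z). \<lambda>i\<in>I. h (x i, z i)) \<in>
    PiM J (\<lambda>_. borel) \<Otimes>\<^sub>M PiM K (\<lambda>_. borel) \<rightarrow>\<^sub>M PiM I (\<lambda>_. borel)"
proof -
  have "(\<lambda>p. h (fst p i, snd p i)) \<in> borel_measurable (PiM J (\<lambda>_. borel) \<Otimes>\<^sub>M PiM K (\<lambda>_. borel))"
    if "i \<in> I" for i
    by (rule measurable_compose[OF _ h], rule measurable_Pair)
      (use that assms(2,3) in \<open>auto intro: measurable_compose[OF measurable_fst measurable_component_singleton]
        measurable_compose[OF measurable_snd measurable_component_singleton]\<close>)
  then show ?thesis unfolding case_prod_beta by (intro measurable_restrict)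
qed

text \<open>The models differ only in the initial law. Each further state is appended by the kernel
  \<open>T\<close>, which both share, so \<open>absolutely_continuous_transfer_kernel\<close>
  carries the induction from the initial laws to any finite horizon.\<close>

lemma HMM_absolutely_continuous_states:
  fixes T :: "'x::polish_space \<Rightarrow> 'x measure" and Q :: "'z::polish_space measure"
  assumes T: "T \<in> borel \<rightarrow>\<^sub>M prob_algebra borel"
    and HMM1: "HMM M1 \<mu> T Q X1 Z1" and HMM2: "HMM M2 \<nu> T Q X2 Z2"
    and ac: "absolutely_continuous \<nu> \<mu>"
  shows "absolutely_continuous (distr M2 (PiM {..n} (\<lambda>_. borel)) (\<lambda>\<omega>. \<lambda>i\<in>{..n}. X2 i \<omega>))
    (distr M1 (PiM {..n} (\<lambda>_. borel)) (\<lambda>\<omega>. \<lambda>i\<in>{..n}. X1 i \<omega>))"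
proof (induction n)
  case 0
  have "absolutely_continuous (distr M2 borel (X2 0)) (distr M1 borel (X1 0))"
    using ac by (simp add: HMM_distr_X0[OF HMM1] HMM_distr_X0[OF HMM2])
  then have AC: "absolutely_continuous
      (distr M2 (PiM {..0} (\<lambda>_. borel)) (\<lambda>\<omega>. (\<lambda>t. \<lambda>i\<in>{..0}. t) (X2 0 \<omega>)))
      (distr M1 (PiM {..0} (\<lambda>_. borel)) (\<lambda>\<omega>. (\<lambda>t. \<lambda>i\<in>{..0}. t) (X1 0 \<omega>)))"
    by (rule absolutely_continuous_distr_compose[OF _ HMM_measurable_X[OF HMM1] HMM_measurable_X[OF HMM2]])
      (intro measurable_restrict, simp)
  have eq: "(\<lambda>\<omega>. \<lambda>i\<in>{..0::nat}. X i \<omega>) = (\<lambda>\<omega>. \<lambda>i\<in>{..0}. X 0 \<omega>)" for X :: "nat \<Rightarrow> 'e \<Rightarrow> 'x"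
    by (auto simp: fun_eq_iff)
  show ?case unfolding eq[of X2] eq[of X1] by (rule AC)
next
  case (Suc n)
  have \<kappa>: "(\<lambda>x. T (x n)) \<in> PiM {..n} (\<lambda>_. borel) \<rightarrow>\<^sub>M prob_algebra borel"
    by (rule measurable_compose[OF _ T]) simp
  have transition: "measure M {\<omega>\<in>space M. (\<lambda>i\<in>{..n}. X i \<omega>) \<in> A \<and> X (Suc n) \<omega> \<in> B}
      = (\<integral>\<omega>. indicator A (\<lambda>i\<in>{..n}. X i \<omega>) * measure (T ((\<lambda>i\<in>{..n}. X i \<omega>) n)) B \<partial>M)"
    if "HMM M \<mu> T Q X Z" "A \<in> sets (PiM {..n} (\<lambda>_. borel))" "B \<in> sets borel"
    for M :: "'e measure" and X Z \<mu> A B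
    using HMM_transition[OF that(1) T that(2,3)] by simp
  have "absolutely_continuous
      (distr M2 (PiM {..n} (\<lambda>_. borel) \<Otimes>\<^sub>M borel) (\<lambda>\<omega>. (\<lambda>i\<in>{..n}. X2 i \<omega>, X2 (Suc n) \<omega>)))
      (distr M1 (PiM {..n} (\<lambda>_. borel) \<Otimes>\<^sub>M borel) (\<lambda>\<omega>. (\<lambda>i\<in>{..n}. X1 i \<omega>, X1 (Suc n) \<omega>)))"
    by (rule absolutely_continuous_transfer_kernel[OF HMM_prob_space[OF HMM1] HMM_prob_space[OF HMM2]
      HMM_restrict_X_measurable[OF HMM1] HMM_measurable_X[OF HMM1]
      HMM_restrict_X_measurable[OF HMM2] HMM_measurable_X[OF HMM2] \<kappa>
      transition[OF HMM1] transition[OF HMM2] Suc.IH])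
  then have AC: "absolutely_continuous
      (distr M2 (PiM (insert (Suc n) {..n}) (\<lambda>_. borel)) (\<lambda>\<omega>. (\<lambda>(f, y). f(Suc n := y)) (\<lambda>i\<in>{..n}. X2 i \<omega>, X2 (Suc n) \<omega>)))
      (distr M1 (PiM (insert (Suc n) {..n}) (\<lambda>_. borel)) (\<lambda>\<omega>. (\<lambda>(f, y). f(Suc n := y)) (\<lambda>i\<in>{..n}. X1 i \<omega>, X1 (Suc n) \<omega>)))"
    by (rule absolutely_continuous_distr_compose[OF _ _ _ measurable_add_dim])
      (intro measurable_Pair HMM_restrict_X_measurable[OF HMM1] HMM_measurable_X[OF HMM1]
        HMM_restrict_X_measurable[OF HMM2] HMM_measurable_X[OF HMM2])+
  have eq: "(\<lambda>\<omega>. (\<lambda>(f, y). f(Suc n := y)) (\<lambda>i\<in>{..n}. X i \<omega>, X (Suc n) \<omega>)) = (\<lambda>\<omega>. \<lambda>i\<in>{..Suc n}. X i \<omega>)"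
    for X :: "nat \<Rightarrow> 'e \<Rightarrow> 'x"
    by (auto simp: fun_eq_iff)
  show ?case
    unfolding eq[of X2, symmetric] eq[of X1, symmetric] unfolding atMost_Suc by (rule AC)
qed

text \<open>The noise vector has the same product law in both models and is independent of the
  states: a shared constant kernel. The observations are a common measurable image of states and
  noise.\<close>

lemma HMM_absolutely_continuous_obs:
  fixes T :: "'x::polish_space \<Rightarrow> 'x measure" and Q :: "'z::polish_space measure"
    and h :: "'x \<times> 'z \<Rightarrow> 'y::polish_space"
  assumes T: "T \<in> borel \<rightarrow>\<^sub>M prob_algebra borel"
    and h: "h \<in> borel_measurable (borel \<Otimes>\<^sub>M borel)"
    and HMM1: "HMM M1 \<mu> T Q X1 Z1" and HMM2: "HMM M2 \<nu> T Q X2 Z2"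
    and ac: "absolutely_continuous \<nu> \<mu>"
  shows "absolutely_continuous (distr M2 (PiM {..<n} (\<lambda>_. borel)) (obs h X2 Z2 {..<n}))
    (distr M1 (PiM {..<n} (\<lambda>_. borel)) (obs h X1 Z1 {..<n}))"
proof -
  \<comment> \<open>The index set \<open>{..n}\<close> goes one beyond what the observations use. It
    is nonempty also for \<open>n = 0\<close>, as \<open>HMM_distr_restrict_Z\<close>
    demands.\<close>
  let ?PX = "PiM {..n} (\<lambda>_. borel :: 'x measure)" and ?PZ = "PiM {..n} (\<lambda>_. borel :: 'z measure)"
  let ?K = "PiM {..n} (\<lambda>_. Q)"
  have distrZ: "?K = distr M ?PZ (\<lambda>\<omega>. \<lambda>i\<in>{..n}. Z i \<omega>)" if "HMM M \<mu> T Q X Z" for M :: "'e measure" and X Z \<mu>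
    using HMM_distr_restrict_Z[OF that, of "{..n}"] by simp
  have K: "(\<lambda>_. ?K) \<in> ?PX \<rightarrow>\<^sub>M prob_algebra ?PZ"
    unfolding distrZ[OF HMM1]
    by (auto simp: space_prob_algebra intro!: prob_space.prob_space_distr HMM_prob_space[OF HMM1]
        HMM_restrict_Z_measurable[OF HMM1] measurable_const)
  have indep: "measure M {\<omega>\<in>space M. (\<lambda>i\<in>{..n}. X i \<omega>) \<in> A \<and> (\<lambda>i\<in>{..n}. Z i \<omega>) \<in> B}
      = (\<integral>\<omega>. indicator A (\<lambda>i\<in>{..n}. X i \<omega>) * measure ?K B \<partial>M)"
    if HMM: "HMM M \<mu> T Q X Z" and A[measurable]: "A \<in> sets ?PX" and B[measurable]: "B \<in> sets ?PZ"
    for M :: "'e measure" and X Z \<mu> A B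
  proof -
    interpret prob_space M by (rule HMM_prob_space[OF HMM])
    note [measurable] = HMM_restrict_X_measurable[OF HMM] HMM_restrict_Z_measurable[OF HMM]
    have "(\<integral>\<omega>. indicator A (\<lambda>i\<in>{..n}. X i \<omega>) * measure ?K B \<partial>M)
        = (\<integral>\<omega>. indicator {\<omega>\<in>space M. (\<lambda>i\<in>{..n}. X i \<omega>) \<in> A} \<omega> \<partial>M) * measure ?K B"
      by (simp add: indicator_def cong: Bochner_Integration.integral_cong)
    also have "\<dots> = measure M {\<omega>\<in>space M. (\<lambda>i\<in>{..n}. X i \<omega>) \<in> A} * measure M {\<omega>\<in>space M. (\<lambda>i\<in>{..n}. Z i \<omega>) \<in> B}"
      unfolding distrZ[OF HMM] by (simp add: measure_distr vimage_def Int_def conj_commute)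
    finally show ?thesis by (simp add: HMM_indep_XZ[OF HMM A B])
  qed
  have "absolutely_continuous
      (distr M2 (?PX \<Otimes>\<^sub>M ?PZ) (\<lambda>\<omega>. (\<lambda>i\<in>{..n}. X2 i \<omega>, \<lambda>i\<in>{..n}. Z2 i \<omega>)))
      (distr M1 (?PX \<Otimes>\<^sub>M ?PZ) (\<lambda>\<omega>. (\<lambda>i\<in>{..n}. X1 i \<omega>, \<lambda>i\<in>{..n}. Z1 i \<omega>)))"
    by (rule absolutely_continuous_transfer_kernel[OF HMM_prob_space[OF HMM1] HMM_prob_space[OF HMM2]
      HMM_restrict_X_measurable[OF HMM1] HMM_restrict_Z_measurable[OF HMM1]
      HMM_restrict_X_measurable[OF HMM2] HMM_restrict_Z_measurable[OF HMM2] K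
      indep[OF HMM1] indep[OF HMM2] HMM_absolutely_continuous_states[OF T HMM1 HMM2 ac]])
  then have AC: "absolutely_continuous
      (distr M2 (PiM {..<n} (\<lambda>_. borel)) (\<lambda>\<omega>. (\<lambda>(x, z). \<lambda>i\<in>{..<n}. h (x i, z i)) (\<lambda>i\<in>{..n}. X2 i \<omega>, \<lambda>i\<in>{..n}. Z2 i \<omega>)))
      (distr M1 (PiM {..<n} (\<lambda>_. borel)) (\<lambda>\<omega>. (\<lambda>(x, z). \<lambda>i\<in>{..<n}. h (x i, z i)) (\<lambda>i\<in>{..n}. X1 i \<omega>, \<lambda>i\<in>{..n}. Z1 i \<omega>)))"
    by (rule absolutely_continuous_distr_compose[OF _ _ _ obs_map_measurable[OF h]])
      (intro measurable_Pair HMM_restrict_X_measurable[OF HMM1] HMM_restrict_Z_measurable[OF HMM1]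
        HMM_restrict_X_measurable[OF HMM2] HMM_restrict_Z_measurable[OF HMM2] | force)+
  have eq: "(\<lambda>\<omega>. (\<lambda>(x, z). \<lambda>i\<in>{..<n}. h (x i, z i)) (\<lambda>i\<in>{..n}. X i \<omega>, \<lambda>i\<in>{..n}. Z i \<omega>)) = obs h X Z {..<n}"
    for X :: "nat \<Rightarrow> 'e \<Rightarrow> 'x" and Z
    by (auto simp: fun_eq_iff obs_def)
  show ?thesis
    unfolding eq[of X2 Z2, symmetric] eq[of X1 Z1, symmetric] by (rule AC)
qed

section \<open>The Bayes update\<close>

text \<open>A function that is not integrable has Bochner integral 0, so a pointwise bound suffices
  and callers are spared measurability arguments.\<close>

lemma (in prob_space) abs_integral_le:
  fixes f :: "'a \<Rightarrow> real"
  assumes "\<And>x. x \<in> space M \<Longrightarrow> \<bar>f x\<bar> \<le> C" "0 \<le> C"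
  shows "\<bar>\<integral>x. f x \<partial>M\<bar> \<le> C"
proof (cases "integrable M f")
  case True
  have "\<bar>\<integral>x. f x \<partial>M\<bar> \<le> (\<integral>x. \<bar>f x\<bar> \<partial>M)" by (rule integral_abs_bound)
  also have "\<dots> \<le> (\<integral>x. C \<partial>M)" by (rule integral_mono) (use True assms in auto)
  finally show ?thesis by (simp add: prob_space)
qed (use assms(2) in \<open>simp add: not_integrable_integral_eq\<close>)

lemma cond_dist_integral:
  fixes \<phi> :: "_ \<Rightarrow> real"
  assumes M: "prob_space M" and obs: "obs h X Z I \<in> M \<rightarrow>\<^sub>M PiM I (\<lambda>_. borel)"
    and X: "X n \<in> borel_measurable M" and F: "cond_dist M h X Z I n F"
    and \<phi>: "\<phi> \<in> borel_measurable (PiM I (\<lambda>_. borel) \<Otimes>\<^sub>M borel)" "\<And>x. \<bar>\<phi> x\<bar> \<le> C"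
  shows "(\<integral>\<omega>. \<phi> (obs h X Z I \<omega>, X n \<omega>) \<partial>M)
      = (\<integral>\<omega>. (\<integral>x. \<phi> (obs h X Z I \<omega>, x) \<partial>F (obs h X Z I \<omega>)) \<partial>M)"
    and "(\<lambda>w. \<integral>x. \<phi> (w, x) \<partial>F w) \<in> borel_measurable (PiM I (\<lambda>_. borel))"
proof -
  have F': "F \<in> PiM I (\<lambda>_. borel) \<rightarrow>\<^sub>M prob_algebra borel"
    using F by (simp add: cond_dist_def)
  have eq: "measure M {\<omega>\<in>space M. obs h X Z I \<omega> \<in> A \<and> X n \<omega> \<in> B} =
        (\<integral>\<omega>. indicator A (obs h X Z I \<omega>) * measure (F (obs h X Z I \<omega>)) B \<partial>M)"
    if "A \<in> sets (PiM I (\<lambda>_. borel))" "B \<in> sets borel" for A B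
    using F that by (auto simp: cond_dist_def)
  show "(\<integral>\<omega>. \<phi> (obs h X Z I \<omega>, X n \<omega>) \<partial>M)
      = (\<integral>\<omega>. (\<integral>x. \<phi> (obs h X Z I \<omega>, x) \<partial>F (obs h X Z I \<omega>)) \<partial>M)"
    by (rule integral_disintegration(1)[OF M obs X F' eq \<phi>])
  show "(\<lambda>w. \<integral>x. \<phi> (w, x) \<partial>F w) \<in> borel_measurable (PiM I (\<lambda>_. borel))"
    by (rule integral_disintegration(2)[OF M obs X F' eq \<phi>])
qed

lemma cond_dist_prob_space:
  assumes "cond_dist M h X Z I n F" "w \<in> space (PiM I (\<lambda>_. borel))"
  shows "prob_space (F w)" "sets (F w) = sets borel"
  using assms measurable_space[of F "PiM I (\<lambda>_. borel)" "prob_algebra borel" w]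
  by (auto simp: cond_dist_def space_prob_algebra)

lemma obs_in_space: "obs h X Z I \<omega> \<in> space (PiM I (\<lambda>_. borel))"
  by (simp add: obs_def space_PiM)

text \<open>Averaged over a prior for \<open>x\<close>, this vanishes for every test function \<open>\<psi>\<close> exactly when \<open>F\<close> is
  the Bayes update of \<open>f\<close> under that prior.\<close>

definition bayes_defect ::
    "('x \<times> 'z \<Rightarrow> 'y) \<Rightarrow> 'z measure \<Rightarrow> nat \<Rightarrow> ((nat \<Rightarrow> 'y) \<Rightarrow> real) \<Rightarrow> ('x \<Rightarrow> real)
      \<Rightarrow> ((nat \<Rightarrow> 'y) \<Rightarrow> real) \<Rightarrow> (nat \<Rightarrow> 'y) \<Rightarrow> 'x \<Rightarrow> real" where
  "bayes_defect h Q n \<psi> f F w x =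
    (\<integral>z. \<psi> (w(n := h (x, z))) * (f x - F (w(n := h (x, z)))) \<partial>Q)"

context
  fixes M :: "'w measure" and \<mu> :: "'x::polish_space measure" and T Q
    and X :: "nat \<Rightarrow> 'w \<Rightarrow> 'x" and Z :: "nat \<Rightarrow> 'w \<Rightarrow> 'z::polish_space"
    and h :: "'x \<times> 'z \<Rightarrow> 'y::polish_space"
  assumes HMM: "HMM M \<mu> T Q X Z"
    and h[measurable]: "h \<in> borel_measurable (borel \<Otimes>\<^sub>M borel)"
begin

lemma HMM_Q: "prob_space Q" "sets Q = sets borel"
  unfolding HMM_distr_Z[OF HMM, of 0, symmetric]
  by (auto intro!: prob_space.prob_space_distr HMM_prob_space[OF HMM] HMM_measurable_Z[OF HMM])

lemma HMM_obs_measurable: "obs h X Z I \<in> M \<rightarrow>\<^sub>M PiM I (\<lambda>_. borel)"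
  by (rule obs_measurable[OF h HMM_measurable_X[OF HMM] HMM_measurable_Z[OF HMM]])

text \<open>Past observations and current state are together a function \<open>g\<close> of the
  states up to \<open>n\<close> and the noise before \<open>n\<close>. Given them,
  \<open>Z n\<close> therefore still has law \<open>Q\<close>.\<close>

lemma HMM_noise_integral:
  fixes \<phi> :: "_ \<Rightarrow> real"
  assumes \<phi>: "\<phi> \<in> borel_measurable ((PiM {..<n} (\<lambda>_. borel) \<Otimes>\<^sub>M borel) \<Otimes>\<^sub>M borel)" "\<And>x. \<bar>\<phi> x\<bar> \<le> C"
  shows "(\<integral>\<omega>. \<phi> ((obs h X Z {..<n} \<omega>, X n \<omega>), Z n \<omega>) \<partial>M)
      = (\<integral>\<omega>. (\<integral>z. \<phi> ((obs h X Z {..<n} \<omega>, X n \<omega>), z) \<partial>Q) \<partial>M)"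
    and "(\<lambda>p. \<integral>z. \<phi> (p, z) \<partial>Q) \<in> borel_measurable (PiM {..<n} (\<lambda>_. borel) \<Otimes>\<^sub>M borel)"
proof -
  interpret prob_space M by (rule HMM_prob_space[OF HMM])
  let ?U = "\<lambda>\<omega>. (obs h X Z {..<n} \<omega>, X n \<omega>)"
  let ?N = "PiM {..<n} (\<lambda>_. borel :: 'y measure) \<Otimes>\<^sub>M (borel :: 'x measure)"
  have U[measurable]: "?U \<in> M \<rightarrow>\<^sub>M ?N"
    by (intro measurable_Pair HMM_obs_measurable HMM_measurable_X[OF HMM])
  have Q: "(\<lambda>_. Q) \<in> ?N \<rightarrow>\<^sub>M prob_algebra borel"
    using HMM_Q by (intro measurable_const) (simp add: space_prob_algebra)
  have eq: "measure M {\<omega>\<in>space M. ?U \<omega> \<in> A \<and> Z n \<omega> \<in> B} = (\<integral>\<omega>. indicator A (?U \<omega>) * measure Q B \<partial>M)"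
    if A[measurable]: "A \<in> sets ?N" and B: "B \<in> sets borel" for A B
  proof -
    let ?PX = "PiM {..n} (\<lambda>_. borel :: 'x measure)" and ?PZ = "PiM {..<n} (\<lambda>_. borel :: 'z measure)"
    let ?V = "\<lambda>\<omega>. (\<lambda>i\<in>{..n}. X i \<omega>, \<lambda>i\<in>{..<n}. Z i \<omega>)"
    define g where "g = (\<lambda>p. ((\<lambda>(x, z). \<lambda>i\<in>{..<n}. h (x i, z i)) p, fst p n))"
    have g: "g \<in> ?PX \<Otimes>\<^sub>M ?PZ \<rightarrow>\<^sub>M ?N"
      unfolding g_def
      by (intro measurable_Pair obs_map_measurable[OF h]
          measurable_compose[OF measurable_fst measurable_component_singleton]) auto
    have gU: "g (?V \<omega>) = ?U \<omega>" for \<omega>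
      by (auto simp: g_def obs_def fun_eq_iff)
    have G: "g -` A \<inter> space (?PX \<Otimes>\<^sub>M ?PZ) \<in> sets (?PX \<Otimes>\<^sub>M ?PZ)" by (rule measurable_sets[OF g A])
    have iff: "?V \<omega> \<in> g -` A \<inter> space (?PX \<Otimes>\<^sub>M ?PZ) \<longleftrightarrow> ?U \<omega> \<in> A" for \<omega>
      unfolding vimage_eq Int_iff gU by (simp add: space_pair_measure space_PiM)
    have "(\<integral>\<omega>. indicator A (?U \<omega>) * measure Q B \<partial>M)
        = (\<integral>\<omega>. indicator {\<omega>\<in>space M. ?U \<omega> \<in> A} \<omega> \<partial>M) * measure Q B"
      by (simp add: indicator_def cong: Bochner_Integration.integral_cong)
    also have "\<dots> = measure M {\<omega>\<in>space M. ?U \<omega> \<in> A} * measure Q B" by simp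
    also have "\<dots> = measure M {\<omega>\<in>space M. ?U \<omega> \<in> A \<and> Z n \<omega> \<in> B}"
      using HMM_indep_future_noise[OF HMM G B] unfolding iff by simp
    finally show ?thesis ..
  qed
  note disint = integral_disintegration[OF HMM_prob_space[OF HMM] U HMM_measurable_Z[OF HMM] Q eq \<phi>]
  show "(\<integral>\<omega>. \<phi> ((obs h X Z {..<n} \<omega>, X n \<omega>), Z n \<omega>) \<partial>M)
      = (\<integral>\<omega>. (\<integral>z. \<phi> ((obs h X Z {..<n} \<omega>, X n \<omega>), z) \<partial>Q) \<partial>M)"
    by (rule disint(1))
  show "(\<lambda>p. \<integral>z. \<phi> (p, z) \<partial>Q) \<in> borel_measurable ?N"
    by (rule disint(2))
qed

text \<open>The last claim integrates out the noise of time \<open>n\<close> only: a quantity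
  depending on the new observation becomes one that depends on the past observations and
  \<open>X n\<close>, ready for the predictor. The bound comes from
  \<open>\<bar>f x - F w\<bar> \<le> 2 * C\<close>.\<close>

lemma bayes_defect_measurable:
  assumes [measurable]: "\<psi> \<in> borel_measurable (PiM {..n} (\<lambda>_. borel))" "F \<in> borel_measurable (PiM {..n} (\<lambda>_. borel))"
    "f \<in> borel_measurable borel"
    and bounds: "\<And>w. \<bar>\<psi> w\<bar> \<le> K" "\<And>x. \<bar>f x\<bar> \<le> C" "\<And>w. \<bar>F w\<bar> \<le> C"
  shows "(\<lambda>(w, x). bayes_defect h Q n \<psi> f F w x) \<in> borel_measurable (PiM {..<n} (\<lambda>_. borel) \<Otimes>\<^sub>M borel)"
    and "\<bar>bayes_defect h Q n \<psi> f F w x\<bar> \<le> K * (2 * C)"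
    and "(\<integral>\<omega>. \<psi> (obs h X Z {..n} \<omega>) * (f (X n \<omega>) - F (obs h X Z {..n} \<omega>)) \<partial>M)
      = (\<integral>\<omega>. bayes_defect h Q n \<psi> f F (obs h X Z {..<n} \<omega>) (X n \<omega>) \<partial>M)"
proof -
  have K0: "K \<ge> 0" using bounds(1)[of undefined] by linarith
  have bd: "\<bar>\<psi> w * (f x - F w')\<bar> \<le> K * (2 * C)" for w w' x
    unfolding abs_mult using bounds(1)[of w] bounds(2)[of x] bounds(3)[of w'] K0
    by (intro mult_mono) auto
  then have "0 \<le> K * (2 * C)" using abs_ge_zero order_trans by blast
  then show "\<bar>bayes_defect h Q n \<psi> f F w x\<bar> \<le> K * (2 * C)"
    unfolding bayes_defect_def by (intro prob_space.abs_integral_le HMM_Q bd)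
  define up where "up p = (fst (fst p))(n := h (snd (fst p), snd p))"
    for p :: "((nat \<Rightarrow> 'y) \<times> 'x) \<times> 'z"
  have up[measurable]: "up \<in> (PiM {..<n} (\<lambda>_. borel) \<Otimes>\<^sub>M borel) \<Otimes>\<^sub>M borel \<rightarrow>\<^sub>M PiM {..n} (\<lambda>_. borel)"
  proof -
    have "(\<lambda>p :: ((nat \<Rightarrow> 'y) \<times> 'x) \<times> 'z. (fst (fst p), h (snd (fst p), snd p)))
        \<in> (PiM {..<n} (\<lambda>_. borel) \<Otimes>\<^sub>M borel) \<Otimes>\<^sub>M borel \<rightarrow>\<^sub>M PiM {..<n} (\<lambda>_. borel) \<Otimes>\<^sub>M borel"
      by (intro measurable_Pair measurable_compose[OF _ h]) measurable
    from measurable_compose[OF this measurable_add_dim[of n "{..<n}" "\<lambda>_. borel"]]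
    have "up \<in> (PiM {..<n} (\<lambda>_. borel) \<Otimes>\<^sub>M borel) \<Otimes>\<^sub>M borel \<rightarrow>\<^sub>M PiM (insert n {..<n}) (\<lambda>_. borel)"
      by (simp add: up_def[abs_def])
    moreover have "insert n {..<n} = {..n}" by auto
    ultimately show ?thesis by simp
  qed
  define \<phi> where "\<phi> p = \<psi> (up p) * (f (snd (fst p)) - F (up p))" for p
  have \<phi>: "\<phi> \<in> borel_measurable ((PiM {..<n} (\<lambda>_. borel) \<Otimes>\<^sub>M borel) \<Otimes>\<^sub>M borel)"
    unfolding \<phi>_def[abs_def] by measurable
  have \<phi>bd: "\<bar>\<phi> p\<bar> \<le> K * (2 * C)" for p unfolding \<phi>_def by (rule bd)
  have eq: "(\<integral>z. \<phi> ((w, x), z) \<partial>Q) = bayes_defect h Q n \<psi> f F w x" for w x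
    by (simp add: \<phi>_def up_def bayes_defect_def)
  show "(\<lambda>(w, x). bayes_defect h Q n \<psi> f F w x) \<in> borel_measurable (PiM {..<n} (\<lambda>_. borel) \<Otimes>\<^sub>M borel)"
    using HMM_noise_integral(2)[OF \<phi> \<phi>bd] by (simp add: eq[symmetric] case_prod_beta)
  show "(\<integral>\<omega>. \<psi> (obs h X Z {..n} \<omega>) * (f (X n \<omega>) - F (obs h X Z {..n} \<omega>)) \<partial>M)
      = (\<integral>\<omega>. bayes_defect h Q n \<psi> f F (obs h X Z {..<n} \<omega>) (X n \<omega>) \<partial>M)"
    using HMM_noise_integral(1)[OF \<phi> \<phi>bd] unfolding eq by (simp add: \<phi>_def up_def obs_atMost)
qed

text \<open>Bayes' rule in tested form. Both sides equal the expectation of \<open>\<psi>\<close>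
  times \<open>f (X n) - F\<close>, taken at the observations up to \<open>n\<close>: conditioning
  on all these observations gives the filter, while integrating out the noise and conditioning on
  the earlier ones gives the predictor. As \<open>F\<close> is arbitrary, the filter of one model
  can be inserted into the other.\<close>

lemma HMM_filter_update:
  assumes pred: "cond_dist M h X Z {..<n} n Pred" and filt: "cond_dist M h X Z {..n} n Filt"
    and \<psi>[measurable]: "\<psi> \<in> borel_measurable (PiM {..n} (\<lambda>_. borel))"
    and F[measurable]: "F \<in> borel_measurable (PiM {..n} (\<lambda>_. borel))"
    and f[measurable]: "f \<in> borel_measurable borel"
    and bounds: "\<And>w. \<bar>\<psi> w\<bar> \<le> K" "\<And>x. \<bar>f x\<bar> \<le> C" "\<And>w. \<bar>F w\<bar> \<le> C"
  shows "(\<integral>\<omega>. \<psi> (obs h X Z {..n} \<omega>) * ((\<integral>x. f x \<partial>Filt (obs h X Z {..n} \<omega>)) - F (obs h X Z {..n} \<omega>)) \<partial>M)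
    = (\<integral>\<omega>. (\<integral>x. bayes_defect h Q n \<psi> f F (obs h X Z {..<n} \<omega>) x \<partial>Pred (obs h X Z {..<n} \<omega>)) \<partial>M)"
    and "(\<lambda>w. \<integral>x. bayes_defect h Q n \<psi> f F w x \<partial>Pred w) \<in> borel_measurable (PiM {..<n} (\<lambda>_. borel))"
proof -
  note bm = bayes_defect_measurable[OF \<psi> F f bounds]
  note P = HMM_prob_space[OF HMM] HMM_obs_measurable HMM_measurable_X[OF HMM]
  have K0: "K \<ge> 0" using bounds(1)[of undefined] by linarith
  have "(\<integral>\<omega>. bayes_defect h Q n \<psi> f F (obs h X Z {..<n} \<omega>) (X n \<omega>) \<partial>M)
     = (\<integral>\<omega>. (\<integral>x. bayes_defect h Q n \<psi> f F (obs h X Z {..<n} \<omega>) x \<partial>Pred (obs h X Z {..<n} \<omega>)) \<partial>M)"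
    using cond_dist_integral(1)[OF P pred bm(1), of "K * (2 * C)"] bm(2) by auto
  moreover have "(\<integral>\<omega>. \<psi> (obs h X Z {..n} \<omega>) * (f (X n \<omega>) - F (obs h X Z {..n} \<omega>)) \<partial>M)
      = (\<integral>\<omega>. \<psi> (obs h X Z {..n} \<omega>) * ((\<integral>x. f x \<partial>Filt (obs h X Z {..n} \<omega>)) - F (obs h X Z {..n} \<omega>)) \<partial>M)"
  proof -
    have 1: "(\<lambda>(w, x). \<psi> w * (f x - F w)) \<in> borel_measurable (PiM {..n} (\<lambda>_. borel) \<Otimes>\<^sub>M borel)"
      by measurable
    have 2: "\<bar>(\<lambda>(w, x). \<psi> w * (f x - F w)) p\<bar> \<le> K * (2 * C)" for p
      unfolding case_prod_beta abs_mult using bounds(1)[of "fst p"] bounds(2)[of "snd p"] bounds(3)[of "fst p"] K0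
      by (intro mult_mono) auto
    have 3: "(\<integral>x. \<psi> w * (f x - F w) \<partial>Filt w) = \<psi> w * ((\<integral>x. f x \<partial>Filt w) - F w)"
      if w: "w \<in> space (PiM {..n} (\<lambda>_. borel))" for w
    proof -
      interpret prob_space "Filt w" by (rule cond_dist_prob_space(1)[OF filt w])
      have [measurable_cong]: "sets (Filt w) = sets borel" by (rule cond_dist_prob_space(2)[OF filt w])
      have "integrable (Filt w) f"
        by (rule integrable_const_bound[where B = C]) (use bounds(2) in auto)
      then show ?thesis by (simp add: prob_space)
    qed
    show ?thesis
      using cond_dist_integral(1)[OF P filt 1 2] unfolding case_prod_conv 3[OF obs_in_space] .
  qed
  ultimately show "(\<integral>\<omega>. \<psi> (obs h X Z {..n} \<omega>) * ((\<integral>x. f x \<partial>Filt (obs h X Z {..n} \<omega>)) - F (obs h X Z {..n} \<omega>)) \<partial>M)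
    = (\<integral>\<omega>. (\<integral>x. bayes_defect h Q n \<psi> f F (obs h X Z {..<n} \<omega>) x \<partial>Pred (obs h X Z {..<n} \<omega>)) \<partial>M)"
    using bm(3) by simp
  show "(\<lambda>w. \<integral>x. bayes_defect h Q n \<psi> f F w x \<partial>Pred w) \<in> borel_measurable (PiM {..<n} (\<lambda>_. borel))"
    using cond_dist_integral(2)[OF P pred bm(1), of "K * (2 * C)"] bm(2) by auto
qed

end

section \<open>Total variation control of the Bayes defect\<close>

lemma integral_diff_le_tv_dist:
  fixes P R :: "'a::topological_space measure"
  assumes P: "prob_space P" "sets P = sets borel" and R: "prob_space R" "sets R = sets borel"
    and f: "f \<in> borel_measurable borel" "\<And>y. \<bar>f y\<bar> \<le> 1"
  shows "\<bar>(\<integral>y. f y \<partial>P) - (\<integral>y. f y \<partial>R)\<bar> \<le> tv_dist P R"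
  unfolding tv_dist_def
proof (rule cSup_upper)
  show "\<bar>(\<integral>y. f y \<partial>P) - (\<integral>y. f y \<partial>R)\<bar> \<in>
      {\<bar>(\<integral>y. f y \<partial>P) - (\<integral>y. f y \<partial>R)\<bar> |f :: 'a \<Rightarrow> real. f \<in> borel_measurable P \<and> (\<forall>y. \<bar>f y\<bar> \<le> 1)}"
    using f P(2) by (auto cong: measurable_cong_sets)
  show "bdd_above {\<bar>(\<integral>y. f y \<partial>P) - (\<integral>y. f y \<partial>R)\<bar> |f :: 'a \<Rightarrow> real. f \<in> borel_measurable P \<and> (\<forall>y. \<bar>f y\<bar> \<le> 1)}"
  proof (rule bdd_aboveI[where M = 2], safe)
    fix f :: "'a \<Rightarrow> real" assume "\<forall>y. \<bar>f y\<bar> \<le> 1"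
    then have "\<bar>\<integral>y. f y \<partial>P\<bar> \<le> 1" "\<bar>\<integral>y. f y \<partial>R\<bar> \<le> 1"
      by (auto intro!: prob_space.abs_integral_le P R)
    then show "\<bar>(\<integral>y. f y \<partial>P) - (\<integral>y. f y \<partial>R)\<bar> \<le> 2" by linarith
  qed
qed

text \<open>The defect equals \<open>f x * a x - C * b x\<close>, where \<open>a\<close> and
  \<open>b\<close> integrate functions of the new observation bounded by 1 against the channel law
  at \<open>x\<close>. Dividing by \<open>C\<close> in \<open>b\<close> is what brings its integrand
  into the test class of \<open>tv_dist\<close>. The estimate does not involve \<open>n\<close>,
  \<open>w\<close>, \<open>\<psi>\<close> or \<open>F\<close>, which is the source of the uniform
  equicontinuity.\<close>

lemma bayes_defect_diff_le:
  fixes h :: "'x::polish_space \<times> 'z::polish_space \<Rightarrow> 'y::polish_space"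
  assumes Q: "prob_space Q" "sets Q = sets borel" and h: "h \<in> borel_measurable (borel \<Otimes>\<^sub>M borel)"
    and w: "w \<in> space (PiM {..<n} (\<lambda>_. borel))"
    and \<psi>: "\<psi> \<in> borel_measurable (PiM {..n} (\<lambda>_. borel))" and F: "F \<in> borel_measurable (PiM {..n} (\<lambda>_. borel))"
    and bounds: "\<And>w. \<bar>\<psi> w\<bar> \<le> 1" "\<And>x. \<bar>f x\<bar> \<le> C" "\<And>w. \<bar>F w\<bar> \<le> C" and C: "0 < C"
  shows "\<bar>bayes_defect h Q n \<psi> f F w x - bayes_defect h Q n \<psi> f F w x'\<bar>
    \<le> \<bar>f x - f x'\<bar> + 2 * C * tv_dist (distr Q borel (\<lambda>z. h (x, z))) (distr Q borel (\<lambda>z. h (x', z)))"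
proof -
  interpret Q: prob_space Q by (rule Q)
  have hx[measurable]: "(\<lambda>z. h (x, z)) \<in> Q \<rightarrow>\<^sub>M borel" for x
    using measurable_Pair2[OF h, of x] Q(2) by (simp cong: measurable_cong_sets)
  have upd: "(\<lambda>y. w(n := y)) \<in> borel \<rightarrow>\<^sub>M PiM {..n} (\<lambda>_. borel)"
  proof -
    have "(\<lambda>y. (\<lambda>(f, y). f(n := y)) (w, y)) \<in> borel \<rightarrow>\<^sub>M PiM (insert n {..<n}) (\<lambda>_. borel)"
      by (rule measurable_compose[OF measurable_Pair1' measurable_add_dim]) (rule w)
    moreover have "insert n {..<n} = {..n}" by auto
    ultimately show ?thesis by simp
  qed
  let ?K = "\<lambda>x. distr Q borel (\<lambda>z. h (x, z))"
  define t where "t = tv_dist (?K x) (?K x')"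
  define a where "a x = (\<integral>z. \<psi> (w(n := h (x, z))) \<partial>Q)" for x
  define b where "b x = (\<integral>z. \<psi> (w(n := h (x, z))) * F (w(n := h (x, z))) / C \<partial>Q)" for x
  have K: "prob_space (?K x)" for x by (rule Q.prob_space_distr[OF hx])
  have diff: "\<bar>(\<integral>z. g (h (x, z)) \<partial>Q) - (\<integral>z. g (h (x', z)) \<partial>Q)\<bar> \<le> t"
    if g: "g \<in> borel_measurable borel" "\<And>y. \<bar>g y\<bar> \<le> 1" for g :: "'y \<Rightarrow> real"
    using integral_diff_le_tv_dist[OF K[of x] _ K[of x'] _ g] g(1)
    by (simp add: integral_distr t_def)
  have \<psi>u[measurable]: "(\<lambda>y. \<psi> (w(n := y))) \<in> borel_measurable borel"
    and Fu[measurable]: "(\<lambda>y. F (w(n := y))) \<in> borel_measurable borel"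
    by (rule measurable_compose[OF upd \<psi>], rule measurable_compose[OF upd F])
  have "\<bar>a x - a x'\<bar> \<le> t"
    unfolding a_def by (rule diff[OF \<psi>u bounds(1)])
  have ratio: "\<bar>\<psi> v * F v / C\<bar> \<le> 1" for v
    using mult_mono[OF bounds(1)[of v] bounds(3)[of v]] C by (simp add: abs_mult)
  have "\<bar>b x - b x'\<bar> \<le> t"
    unfolding b_def
    by (rule diff[of "\<lambda>y. \<psi> (w(n := y)) * F (w(n := y)) / C"]) (measurable, rule ratio)
  have "\<bar>a y\<bar> \<le> 1" for y unfolding a_def by (rule Q.abs_integral_le) (use bounds in auto)
  have eq: "bayes_defect h Q n \<psi> f F w y = f y * a y - C * b y" for y
  proof -
    have i1: "integrable Q (\<lambda>z. \<psi> (w(n := h (y, z))))"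
      by (rule Q.integrable_const_bound[where B = 1])
        (use bounds measurable_compose[OF hx \<psi>u] in auto)
    have i2: "integrable Q (\<lambda>z. \<psi> (w(n := h (y, z))) * F (w(n := h (y, z))) / C)"
      by (rule Q.integrable_const_bound[where B = 1])
        (use ratio measurable_compose[OF hx \<psi>u] measurable_compose[OF hx Fu] in auto)
    have "bayes_defect h Q n \<psi> f F w y
        = (\<integral>z. f y * \<psi> (w(n := h (y, z))) - C * (\<psi> (w(n := h (y, z))) * F (w(n := h (y, z))) / C) \<partial>Q)"
      unfolding bayes_defect_def using C by (intro Bochner_Integration.integral_cong) (auto simp: field_simps)
    also have "\<dots> = f y * a y - C * b y"
      unfolding a_def b_def
      by (subst Bochner_Integration.integral_diff)
        (auto intro!: integrable_mult_right i1 i2 simp del: times_divide_eq_right)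
    finally show ?thesis .
  qed
  \<comment> \<open>The first term uses \<open>\<bar>a x\<bar> \<le> 1\<close>; each of the other
    two contributes \<open>C * t\<close>, the middle one because
    \<open>\<bar>f x'\<bar> \<le> C\<close>.\<close>
  have "bayes_defect h Q n \<psi> f F w x - bayes_defect h Q n \<psi> f F w x'
      = (f x - f x') * a x + f x' * (a x - a x') - C * (b x - b x')"
    unfolding eq by (simp add: algebra_simps)
  also have "\<bar>\<dots>\<bar> \<le> \<bar>(f x - f x') * a x\<bar> + \<bar>f x' * (a x - a x')\<bar> + \<bar>C * (b x - b x')\<bar>" by linarith
  also have "\<dots> \<le> \<bar>f x - f x'\<bar> * 1 + C * t + C * t"
    unfolding abs_mult using C bounds(2)[of x'] \<open>\<bar>a x\<bar> \<le> 1\<close> \<open>\<bar>a x - a x'\<bar> \<le> t\<close> \<open>\<bar>b x - b x'\<bar> \<le> t\<close>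
    by (intro add_mono mult_mono) auto
  finally show ?thesis by (simp add: t_def)
qed

section \<open>Merging of the filters\<close>

theorem theorem4:
  fixes T :: "'x::polish_space \<Rightarrow> 'x measure"
    and Q :: "'z::polish_space measure"
    and h :: "'x \<times> 'z \<Rightarrow> 'y::polish_space"
    and \<mu> \<nu> :: "'x measure"
    and M1 :: "'a measure" and X1 :: "nat \<Rightarrow> 'a \<Rightarrow> 'x" and Z1 :: "nat \<Rightarrow> 'a \<Rightarrow> 'z"
    and M2 :: "'b measure" and X2 :: "nat \<Rightarrow> 'b \<Rightarrow> 'x" and Z2 :: "nat \<Rightarrow> 'b \<Rightarrow> 'z"
    and Pred1 Pred2 Filt1 Filt2 :: "nat \<Rightarrow> (nat \<Rightarrow> 'y) \<Rightarrow> 'x measure"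
  assumes T: "T \<in> borel \<rightarrow>\<^sub>M prob_algebra borel"
    and Q: "prob_space Q" "sets Q = sets borel"
    and h: "h \<in> borel_measurable (borel \<Otimes>\<^sub>M borel)"
    and mu: "prob_space \<mu>" "sets \<mu> = sets borel"
    and nu: "prob_space \<nu>" "sets \<nu> = sets borel"
    and ac: "absolutely_continuous \<nu> \<mu>"
    and tv_cont: "\<And>a an. an \<longlonglongrightarrow> a \<Longrightarrow>
        (\<lambda>n. tv_dist (distr Q borel (\<lambda>z. h (an n, z))) (distr Q borel (\<lambda>z. h (a, z)))) \<longlonglongrightarrow> 0"
    and HMM1: "HMM M1 \<mu> T Q X1 Z1"
    and HMM2: "HMM M2 \<nu> T Q X2 Z2"
    and pred1: "\<And>n. cond_dist M1 h X1 Z1 {..<n} n (Pred1 n)"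
    and pred2: "\<And>n. cond_dist M2 h X2 Z2 {..<n} n (Pred2 n)"
    and filt1: "\<And>n. cond_dist M1 h X1 Z1 {..n} n (Filt1 n)"
    and filt2: "\<And>n. cond_dist M2 h X2 Z2 {..n} n (Filt2 n)"
    and pred_merge: "AE \<omega> in M1. \<forall>f\<in>Cb.
        (\<lambda>n. \<bar>(\<integral>x. f x \<partial>Pred1 n (obs h X1 Z1 {..<n} \<omega>))
              - (\<integral>x. f x \<partial>Pred2 n (obs h X1 Z1 {..<n} \<omega>))\<bar>) \<longlonglongrightarrow> 0"
  shows "\<forall>f\<in>Cb.
     (\<lambda>n. \<integral>\<omega>. \<bar>(\<integral>x. f x \<partial>Filt1 n (obs h X1 Z1 {..n} \<omega>))
                 - (\<integral>x. f x \<partial>Filt2 n (obs h X1 Z1 {..n} \<omega>))\<bar> \<partial>M1) \<longlonglongrightarrow> 0"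
proof
  fix f :: "'x \<Rightarrow> real" assume f: "f \<in> Cb"
  define K where "K a = distr Q borel (\<lambda>z. h (a, z))" for a
  have contf: "continuous_on UNIV f" using f by (simp add: Cb_def)
  have [measurable]: "f \<in> borel_measurable borel" by (rule borel_measurable_continuous_onI[OF contf])
  obtain C where C: "0 < C" and fC: "\<And>x. \<bar>f x\<bar> \<le> C"
    using f unfolding Cb_def bounded_pos by auto
  note P1 = HMM_prob_space[OF HMM1] and P2 = HMM_prob_space[OF HMM2]
  \<comment> \<open>The update lemma needs bounds at every argument, whereas the filter kernels are
    known to be probability measures only on the product space. Clipping supplies the bound
    everywhere and changes nothing at observation records.\<close>
  define clip where "clip t = max (- C) (min C t)" for t
  have clip_bound: "\<bar>clip t\<bar> \<le> C" for t using C by (auto simp: clip_def)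
  define F1 where "F1 n w = clip (\<integral>x. f x \<partial>Filt1 n w)" for n w
  define F2 where "F2 n w = clip (\<integral>x. f x \<partial>Filt2 n w)" for n w
  have filt_clip: "clip (\<integral>x. f x \<partial>Filt w) = (\<integral>x. f x \<partial>Filt w)"
    if "cond_dist M h X Z {..n} n Filt" "w \<in> space (PiM {..n} (\<lambda>_. borel))"
    for M :: "'e measure" and X Z n Filt w
    using prob_space.abs_integral_le[OF cond_dist_prob_space(1)[OF that], of f C] fC C by (auto simp: clip_def)
  have filt_measurable: "(\<lambda>w. clip (\<integral>x. f x \<partial>Filt w)) \<in> borel_measurable (PiM {..n} (\<lambda>_. borel))"
    if "cond_dist M h X Z {..n} n Filt" for M :: "'e measure" and X Z n Filt
  proof -
    have "Filt \<in> PiM {..n} (\<lambda>_. borel) \<rightarrow>\<^sub>M subprob_algebra borel"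
      using that by (auto simp: cond_dist_def intro: measurable_prob_algebraD)
    from measurable_compose[OF this integral_measurable_subprob_algebra, of f]
    show ?thesis unfolding clip_def by measurable
  qed
  have [measurable]: "F1 n \<in> borel_measurable (PiM {..n} (\<lambda>_. borel))"
      "F2 n \<in> borel_measurable (PiM {..n} (\<lambda>_. borel))" for n
    unfolding F1_def[abs_def] F2_def[abs_def] by (rule filt_measurable[OF filt1], rule filt_measurable[OF filt2])
  have F2m: "F2 n \<in> borel_measurable (PiM {..n} (\<lambda>_. borel))" for n by measurable
  have F2C: "\<bar>F2 n w\<bar> \<le> C" for n w unfolding F2_def by (rule clip_bound)
  define \<psi> where "\<psi> n w = sgn (F1 n w - F2 n w)" for n w
  have \<psi>m[measurable]: "\<psi> n \<in> borel_measurable (PiM {..n} (\<lambda>_. borel))" for n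
    unfolding \<psi>_def[abs_def] by measurable
  have \<psi>1: "\<bar>\<psi> n w\<bar> \<le> 1" for n w by (simp add: \<psi>_def abs_sgn_eq)
  define D where "D n w x = bayes_defect h Q n (\<psi> n) f (F2 n) w x" for n w x
  define J1 where "J1 n w = (\<integral>x. D n w x \<partial>Pred1 n w)" for n w
  define J2 where "J2 n w = (\<integral>x. D n w x \<partial>Pred2 n w)" for n w
  have fm: "f \<in> borel_measurable borel" by measurable
  note update1 = HMM_filter_update[OF HMM1 h pred1 filt1 \<psi>m F2m fm \<psi>1 fC F2C, folded D_def, folded J1_def]
  note update2 = HMM_filter_update[OF HMM2 h pred2 filt2 \<psi>m F2m fm \<psi>1 fC F2C, folded D_def, folded J2_def]
  have D_bound: "\<bar>D n w x\<bar> \<le> 2 * C" for n w x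
    using bayes_defect_measurable(2)[OF HMM1 h \<psi>m F2m fm \<psi>1 fC F2C] by (simp add: D_def)
  have J_bound: "\<bar>\<integral>x. D n w x \<partial>Pred w\<bar> \<le> 2 * C"
    if "cond_dist M h X Z {..<n} n Pred" "w \<in> space (PiM {..<n} (\<lambda>_. borel))"
    for M :: "'e measure" and X Z n Pred w
    using C by (intro prob_space.abs_integral_le[OF cond_dist_prob_space(1)[OF that]] D_bound) auto

  \<comment> \<open>Since \<open>\<psi>\<close> is the sign of the difference, the absolute error is
    \<open>\<psi>\<close> times the difference, and \<open>update1\<close> with \<open>F2\<close> as
    the comparison function turns it into \<open>J1\<close>. Almost sure convergence of the bounded
    \<open>J1\<close> to 0 will then suffice.\<close>
  have error: "(\<integral>\<omega>. \<bar>(\<integral>x. f x \<partial>Filt1 n (obs h X1 Z1 {..n} \<omega>)) - (\<integral>x. f x \<partial>Filt2 n (obs h X1 Z1 {..n} \<omega>))\<bar> \<partial>M1)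
      = (\<integral>\<omega>. J1 n (obs h X1 Z1 {..<n} \<omega>) \<partial>M1)" for n
  proof -
    have "(\<integral>\<omega>. \<bar>(\<integral>x. f x \<partial>Filt1 n (obs h X1 Z1 {..n} \<omega>)) - (\<integral>x. f x \<partial>Filt2 n (obs h X1 Z1 {..n} \<omega>))\<bar> \<partial>M1)
      = (\<integral>\<omega>. \<psi> n (obs h X1 Z1 {..n} \<omega>) * ((\<integral>x. f x \<partial>Filt1 n (obs h X1 Z1 {..n} \<omega>)) - F2 n (obs h X1 Z1 {..n} \<omega>)) \<partial>M1)"
    proof (rule Bochner_Integration.integral_cong[OF refl])
      fix \<omega>
      show "\<bar>(\<integral>x. f x \<partial>Filt1 n (obs h X1 Z1 {..n} \<omega>)) - (\<integral>x. f x \<partial>Filt2 n (obs h X1 Z1 {..n} \<omega>))\<bar>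
        = \<psi> n (obs h X1 Z1 {..n} \<omega>) * ((\<integral>x. f x \<partial>Filt1 n (obs h X1 Z1 {..n} \<omega>)) - F2 n (obs h X1 Z1 {..n} \<omega>))"
        unfolding \<psi>_def F1_def F2_def filt_clip[OF filt1 obs_in_space] filt_clip[OF filt2 obs_in_space]
        by (simp add: abs_sgn mult.commute)
    qed
    then show ?thesis using update1(1) by simp
  qed

  have J2_zero: "AE \<omega> in M1. J2 n (obs h X1 Z1 {..<n} \<omega>) = 0" for n
  proof -
    have restrict_space: "restrict w {..<n} \<in> space (PiM {..<n} (\<lambda>_. borel))" for w :: "nat \<Rightarrow> 'y"
      by (simp add: space_PiM)
    \<comment> \<open>Since \<open>F2\<close> is the filter of the second model, the tested error
      there is 0 for every bounded test function. A factor depending only on the past comes out of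
      the defect (\<open>defect\<close>), so multiplying \<open>\<psi>\<close> by \<open>J2\<close>
      itself shows that \<open>J2\<close> has second moment 0. The restriction discards the newest
      observation, on which \<open>J2\<close> must not depend.\<close>
    define \<psi>' where "\<psi>' w = J2 n (restrict w {..<n}) * \<psi> n w" for w
    have [measurable]: "J2 n \<in> borel_measurable (PiM {..<n} (\<lambda>_. borel))" by (rule update2(2))
    have [measurable]: "(\<lambda>w. restrict w {..<n}) \<in> PiM {..n} (\<lambda>_. borel :: 'y measure) \<rightarrow>\<^sub>M PiM {..<n} (\<lambda>_. borel)"
      by (rule measurable_restrict_subset) auto
    have \<psi>'m: "\<psi>' \<in> borel_measurable (PiM {..n} (\<lambda>_. borel))" unfolding \<psi>'_def[abs_def] by measurable
    have J2b: "\<bar>J2 n w\<bar> \<le> 2 * C" if "w \<in> space (PiM {..<n} (\<lambda>_. borel))" for w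
      unfolding J2_def by (rule J_bound[OF pred2 that])
    have \<psi>'b: "\<bar>\<psi>' w\<bar> \<le> 2 * C * 1" for w
      unfolding \<psi>'_def abs_mult using C by (intro mult_mono J2b restrict_space \<psi>1) auto
    have defect: "bayes_defect h Q n \<psi>' f (F2 n) w x = J2 n w * D n w x"
      if w: "w \<in> space (PiM {..<n} (\<lambda>_. borel))" for w x
    proof -
      have "restrict (w(n := y)) {..<n} = w" for y
        using w by (auto simp: space_PiM PiE_def extensional_def restrict_def fun_eq_iff)
      then show ?thesis by (simp add: bayes_defect_def D_def \<psi>'_def mult.assoc)
    qed
    have "0 = (\<integral>\<omega>. \<psi>' (obs h X2 Z2 {..n} \<omega>) * ((\<integral>x. f x \<partial>Filt2 n (obs h X2 Z2 {..n} \<omega>)) - F2 n (obs h X2 Z2 {..n} \<omega>)) \<partial>M2)"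
      unfolding F2_def filt_clip[OF filt2 obs_in_space] by simp
    also have "\<dots> = (\<integral>\<omega>. J2 n (obs h X2 Z2 {..<n} \<omega>) * J2 n (obs h X2 Z2 {..<n} \<omega>) \<partial>M2)"
      unfolding HMM_filter_update(1)[OF HMM2 h pred2 filt2 \<psi>'m F2m fm \<psi>'b fC F2C] defect[OF obs_in_space]
      by (simp add: J2_def)
    finally have zero: "(\<integral>\<omega>. J2 n (obs h X2 Z2 {..<n} \<omega>) * J2 n (obs h X2 Z2 {..<n} \<omega>) \<partial>M2) = 0" ..
    note [measurable] = HMM_obs_measurable[OF HMM1 h] HMM_obs_measurable[OF HMM2 h]
    have "\<bar>J2 n w * J2 n w\<bar> \<le> (2 * C) * (2 * C)" if "w \<in> space (PiM {..<n} (\<lambda>_. borel))" for w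
      unfolding abs_mult using J2b[OF that] by (intro mult_mono) auto
    then have "integrable M2 (\<lambda>\<omega>. J2 n (obs h X2 Z2 {..<n} \<omega>) * J2 n (obs h X2 Z2 {..<n} \<omega>))"
      by (intro finite_measure.integrable_const_bound[OF prob_space.finite_measure[OF P2], where B = "(2 * C) * (2 * C)"])
        (simp_all only: real_norm_def obs_in_space AE_I2, measurable)
    from integral_nonneg_eq_0_iff_AE[OF this] zero
    have "AE \<omega> in M2. J2 n (obs h X2 Z2 {..<n} \<omega>) = 0" by simp
    then have "AE w in distr M2 (PiM {..<n} (\<lambda>_. borel)) (obs h X2 Z2 {..<n}). J2 n w = 0"
      by (subst AE_distr_iff) measurable
    \<comment> \<open>The vanishing is known for records drawn from the second model, but it is
      needed for those of the first; absolute continuity at the finite horizon \<open>n\<close>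
      transfers it.\<close>
    then have "AE w in distr M1 (PiM {..<n} (\<lambda>_. borel)) (obs h X1 Z1 {..<n}). J2 n w = 0"
      by (rule absolutely_continuous_AE[OF _ HMM_absolutely_continuous_obs[OF T h HMM1 HMM2 ac], rotated]) simp
    then show ?thesis by (subst (asm) AE_distr_iff) measurable
  qed

  \<comment> \<open>The path \<open>w\<close> is arbitrary, with a different record at each time:
    the modulus of continuity involves only \<open>f\<close> and the channel near
    \<open>x\<close>.\<close>
  have equi: "\<exists>d>0. \<forall>y n. dist y x < d \<longrightarrow> \<bar>D n (w n) y - D n (w n) x\<bar> \<le> e"
    if e: "0 < e" and w: "\<And>n. w n \<in> space (PiM {..<n} (\<lambda>_. borel))" for e x w
  proof -
    have "((\<lambda>y. \<bar>f y - f x\<bar> + 2 * C * tv_dist (K y) (K x)) \<longlongrightarrow> \<bar>f x - f x\<bar> + 2 * C * 0) (at x)"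
    proof (intro tendsto_intros)
      show "(f \<longlongrightarrow> f x) (at x)" using contf by (simp add: continuous_on_def)
      show "((\<lambda>y. tv_dist (K y) (K x)) \<longlongrightarrow> 0) (at x)"
        unfolding tendsto_at_iff_sequentially by (auto simp: comp_def K_def intro: tv_cont)
    qed
    then have "\<forall>\<^sub>F y in at x. \<bar>f y - f x\<bar> + 2 * C * tv_dist (K y) (K x) < e"
      using e by (intro order_tendstoD(2)) auto
    then obtain d where d: "0 < d" "\<And>y. y \<noteq> x \<Longrightarrow> dist y x < d \<Longrightarrow> \<bar>f y - f x\<bar> + 2 * C * tv_dist (K y) (K x) < e"
      by (auto simp: eventually_at)
    have "\<bar>D n (w n) y - D n (w n) x\<bar> \<le> e" if "dist y x < d" for y n
    proof (cases "y = x")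
      case False
      have "\<bar>D n (w n) y - D n (w n) x\<bar> \<le> \<bar>f y - f x\<bar> + 2 * C * tv_dist (K y) (K x)"
        unfolding D_def K_def by (rule bayes_defect_diff_le[OF Q h w \<psi>m F2m \<psi>1 fC F2C C])
      then show ?thesis using d(2)[OF False that] by linarith
    qed (use e in simp)
    with d(1) show ?thesis by blast
  qed

  \<comment> \<open>Along a fixed path the functions \<open>D\<close> form one deterministic
    equicontinuous sequence, bounded by \<open>2 * C\<close>. Their integrals against the two
    predictors merge, and those against the second are all 0.\<close>
  have J1_lim_at: "(\<lambda>n. J1 n (obs h X1 Z1 {..<n} \<omega>)) \<longlonglongrightarrow> 0"
    if merge: "\<forall>f\<in>Cb. (\<lambda>n. \<bar>(\<integral>x. f x \<partial>Pred1 n (obs h X1 Z1 {..<n} \<omega>))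
              - (\<integral>x. f x \<partial>Pred2 n (obs h X1 Z1 {..<n} \<omega>))\<bar>) \<longlonglongrightarrow> 0"
      and zero: "\<forall>n. J2 n (obs h X1 Z1 {..<n} \<omega>) = 0" for \<omega>
  proof -
    let ?w = "\<lambda>n. obs h X1 Z1 {..<n} \<omega>"
    have "(\<lambda>n. (\<integral>x. D n (?w n) x \<partial>Pred1 n (?w n)) - (\<integral>x. D n (?w n) x \<partial>Pred2 n (?w n))) \<longlonglongrightarrow> 0"
    proof (rule weak_merging_equicontinuous[where P = "\<lambda>n. Pred1 n (?w n)" and R = "\<lambda>n. Pred2 n (?w n)"
        and g = "\<lambda>n. D n (?w n)" and C = "2 * C"])
      show "(\<lambda>n. (\<integral>x. g x \<partial>Pred1 n (?w n)) - (\<integral>x. g x \<partial>Pred2 n (?w n))) \<longlonglongrightarrow> 0" if "g \<in> Cb" for g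
        by (rule tendsto_rabs_zero_cancel) (use merge that in blast)
      show "\<exists>d>0. \<forall>y n. dist y x < d \<longrightarrow> \<bar>D n (?w n) y - D n (?w n) x\<bar> \<le> e" if "0 < e" for x e
        by (rule equi[OF that obs_in_space])
    qed (rule cond_dist_prob_space[OF pred1 obs_in_space] cond_dist_prob_space[OF pred2 obs_in_space] D_bound)+
    then show ?thesis using zero by (simp add: J1_def J2_def)
  qed
  have J2_all: "AE \<omega> in M1. \<forall>n. J2 n (obs h X1 Z1 {..<n} \<omega>) = 0"
    using J2_zero by (simp add: AE_all_countable)
  have J1_lim: "AE \<omega> in M1. (\<lambda>n. J1 n (obs h X1 Z1 {..<n} \<omega>)) \<longlonglongrightarrow> 0"
    by (rule AE_mp[OF J2_all AE_mp[OF pred_merge]]) (intro AE_I2 impI J1_lim_at)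

  have "(\<lambda>n. \<integral>\<omega>. J1 n (obs h X1 Z1 {..<n} \<omega>) \<partial>M1) \<longlonglongrightarrow> (\<integral>\<omega>. 0 \<partial>M1)"
  proof (rule integral_dominated_convergence[OF _ _ _ J1_lim])
    show "(\<lambda>\<omega>. J1 n (obs h X1 Z1 {..<n} \<omega>)) \<in> borel_measurable M1" for n
      by (rule measurable_compose[OF HMM_obs_measurable[OF HMM1 h] update1(2)])
    show "integrable M1 (\<lambda>_. 2 * C)"
      using finite_measure.integrable_const[OF prob_space.finite_measure[OF P1]] .
    show "AE \<omega> in M1. norm (J1 n (obs h X1 Z1 {..<n} \<omega>)) \<le> 2 * C" for n
      unfolding J1_def real_norm_def by (intro AE_I2 J_bound[OF pred1 obs_in_space])
  qed simp
  then show "(\<lambda>n. \<integral>\<omega>. \<bar>(\<integral>x. f x \<partial>Filt1 n (obs h X1 Z1 {..n} \<omega>))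
                 - (\<integral>x. f x \<partial>Filt2 n (obs h X1 Z1 {..n} \<omega>))\<bar> \<partial>M1) \<longlonglongrightarrow> 0"
    unfolding error by simp
qed

end
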